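(* Let $T=[v_0,v_1,v_2,v_3]\subset\mathbb R^3$ be a tetrahedron. The vertex Hermite degrees of freedom $z(v_i)$ and $\nabla z(v_i)$, $i=0,\dots,3$, are unisolvent for the reduced singular Zienkiewicz space $Z_3^{\mathrm{red}}(T)$; that is, the linear map $Z_3^{\mathrm{red}}(T)\to\mathbb R^{16}$, $z\mapsto(z(v_i),\nabla z(v_i))_{i=0,\dots,3}$, is bijective.
   Context: $T=[v_0,v_1,v_2,v_3]\subset\mathbb R^3$ is a (nondegenerate) tetrahedron with barycentric coordinates $\lambda_0,\dots,\lambda_3$. Set $I=\{0,1,2,3\}$, $J_i=I\setminus\{i\}$. Let $f_i=\{\lambda_i=0\}$ be the face opposite to $v_i$, $\nu_i$ its outer unit normal, and $d_{ji}=\nabla\lambda_j\cdot\nu_i$. For $\ell\neq m$ let $e_{\ell m}=[v_\ell,v_m]$. $\mathcal P_k$ denotes polynomials of total degree at most $k$. Polynomial Zienkiewicz space: $Z_3^0(T)=\mathcal P_2(T)\oplus\mathrm{span}\{\lambda_i^2\lambda_j-\lambda_j^2\lambda_i:0\le i<j\le3\}$. Singular edge bubbles: for $0\le\ell<m\le3$ and $n\in I\setminus\{\ell,m\}$, $$E_{\ell m}^n=\frac{\lambda_n\lambda_\ell^2\lambda_m^2}{(\lambda_n+\lambda_\ell)(\lambda_n+\lambda_m)}.$$ Edge-enriched space: $Z_3^e(T)=Z_3^0(T)+\mathrm{span}\{E_{\ell m}^n:0\le\ell<m\le3,\ n\in I\setminus\{\ell,m\}\}$. On the face $f_i$ put $\mu_j=\lambda_j|_{f_i}$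 for $j\in J_i$. For an edge $e_{\ell m}\subset f_i$ ($\ell<m$) with $\{n\}=I\setminus\{i,\ell,m\}$ set $$\Phi_{\ell m,\ell}^{n,i}=\frac{\mu_n\mu_\ell\mu_m^2(2\mu_n+\mu_\ell)}{(\mu_n+\mu_\ell)^2(\mu_n+\mu_m)},\quad \Phi_{\ell m,m}^{n,i}=\frac{\mu_n\mu_\ell^2\mu_m(2\mu_n+\mu_m)}{(\mu_n+\mu_\ell)(\mu_n+\mu_m)^2},$$ $$\Phi_{\ell m,n}^{n,i}=\frac{\mu_\ell^2\mu_m^2(\mu_\ell\mu_m-\mu_n^2)}{(\mu_n+\mu_\ell)^2(\mu_n+\mu_m)^2}-\mu_\ell\mu_m,$$ and let $Q_{\mathrm{edge}}(f_i)$ be the span of these functions over all edges $e_{\ell m}\subset f_i$. For $q\in Q_{\mathrm{edge}}(f_i)$ the canonical barycentric extension $\widetilde q$ to $T$ is obtained by replacing $\mu_j$ by $\lambda_j$ for all $j\in J_i$ in these formulas (extended linearly). The normal lift is $$L_iq=\frac{\lambda_i}{d_{ii}}\Theta_i\,\widetilde q,\qquad \Theta_i=\prod_{j\in J_i}\frac{\lambda_j}{\lambda_i+\lambda_j}.$$ Every $z\in Z_3^e(T)$ has on each face a unique decomposition $\partial_{\nu_i}z|_{f_i}=p_i(z)+q_i(z)$ with $p_i(z)\in\mathcal P_2(f_i)$, $q_i(z)\in Q_{\mathrm{edge}}(f_i)$. Set $\mathcal R_Tz=z-\sum_{i=0}^3L_iq_i(z)$ and $Z_3^{\mathrm{sing}}(T)=\mathcal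 R_TZ_3^e(T)$. The reduced singular Zienkiewicz space is $$Z_3^{\mathrm{red}}(T)=\{z\in Z_3^{\mathrm{sing}}(T):\partial_{\nu_i}z|_{f_i}\in\mathcal P_1(f_i)\text{ for all }i=0,\dots,3\}.$$ Values and gradients at points of $\partial T$ are understood by continuous extension. *)

theory Defs
  imports "HOL-Analysis.Analysis" "HOL-Library.Function_Algebras"
begin

instantiation "fun" :: (type, real_vector) real_vector
begin

definition scaleR_fun :: "real \<Rightarrow> ('a \<Rightarrow> 'b) \<Rightarrow> 'a \<Rightarrow> 'b" where
  "scaleR_fun c f = (\<lambda>x. c *\<^sub>R f x)"

instance
  by standard (auto simp: scaleR_fun_def fun_eq_iff algebra_simps)

end

text \<open>
  A function with domain \<open>S\<close> is represented by a total function that vanishes outside \<open>S\<close>, so that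
  equality of functions is equality on \<open>S\<close>.  A function on the tetrahedron \<open>T\<close> is given on the
  interior of \<open>T\<close>, where all rational functions below are regular; its values and gradients on the
  boundary are limits from the interior.
\<close>

definition on_set :: "'a set \<Rightarrow> ('a \<Rightarrow> real) \<Rightarrow> 'a \<Rightarrow> real" where
  "on_set S f = (\<lambda>x. if x \<in> S then f x else 0)"

definition grad :: "(real^3 \<Rightarrow> real) \<Rightarrow> real^3 \<Rightarrow> real^3" where
  "grad f x = (THE D. GDERIV f x :> D)"

text \<open>
  The vertices, and everything attached to them, are indexed by the four-element type, whose
  elements are \<open>0 < 1 < 2 < 3\<close> (and \<open>4 = 0\<close>).
\<close>

definition tetrahedron :: "(4 \<Rightarrow> real^3) \<Rightarrow> (real^3) set" where
  "tetrahedron v = convex hull (range v)"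

definition nondegenerate :: "(4 \<Rightarrow> real^3) \<Rightarrow> bool" where
  "nondegenerate v \<longleftrightarrow> inj v \<and> \<not> affine_dependent (range v)"

text \<open>\<open>bary v x j\<close> is \<open>\<lambda>\<^sub>j(x)\<close>, as an affine function on the whole space.\<close>

definition bary :: "(4 \<Rightarrow> real^3) \<Rightarrow> real^3 \<Rightarrow> 4 \<Rightarrow> real" where
  "bary v x = (THE a. (\<Sum>j\<in>UNIV. a j) = 1 \<and> (\<Sum>j\<in>UNIV. a j *\<^sub>R v j) = x)"

definition face :: "(4 \<Rightarrow> real^3) \<Rightarrow> 4 \<Rightarrow> (real^3) set" where
  "face v i = {x \<in> tetrahedron v. bary v x i = 0}"

definition outer_normal :: "(4 \<Rightarrow> real^3) \<Rightarrow> 4 \<Rightarrow> real^3" where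
  "outer_normal v i = (THE \<nu>. norm \<nu> = 1
      \<and> (\<forall>x\<in>face v i. \<forall>y\<in>face v i. \<nu> \<bullet> (x - y) = 0)
      \<and> (\<forall>x\<in>face v i. \<nu> \<bullet> (v i - x) < 0))"

text \<open>The gradient of \<open>\<lambda>\<^sub>j\<close> is constant; it is evaluated at the vertex \<open>v\<^sub>j\<close>.\<close>

definition dcoef :: "(4 \<Rightarrow> real^3) \<Rightarrow> 4 \<Rightarrow> 4 \<Rightarrow> real" where
  "dcoef v j i = grad (\<lambda>x. bary v x j) (v j) \<bullet> outer_normal v i"

definition polys :: "nat \<Rightarrow> (real^3 \<Rightarrow> real) set" where
  "polys k = span {(\<lambda>x. \<Prod>j\<in>UNIV. (x $ j) ^ a j) | a :: 3 \<Rightarrow> nat. (\<Sum>j\<in>UNIV. a j) \<le> k}"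

definition polys_on :: "(real^3) set \<Rightarrow> nat \<Rightarrow> (real^3 \<Rightarrow> real) set" where
  "polys_on S k = on_set S ` polys k"

definition Z3_0 :: "(4 \<Rightarrow> real^3) \<Rightarrow> (real^3 \<Rightarrow> real) set" where
  "Z3_0 v = {p + w | p w. p \<in> polys_on (interior (tetrahedron v)) 2 \<and>
     w \<in> span {on_set (interior (tetrahedron v))
                 (\<lambda>x. (bary v x i)\<^sup>2 * bary v x j - (bary v x j)\<^sup>2 * bary v x i) | i j. i < j}}"

definition edge_bubble :: "(4 \<Rightarrow> real^3) \<Rightarrow> 4 \<Rightarrow> 4 \<Rightarrow> 4 \<Rightarrow> real^3 \<Rightarrow> real" where
  "edge_bubble v l m n = on_set (interior (tetrahedron v))
     (\<lambda>x. bary v x n * (bary v x l)\<^sup>2 * (bary v x m)\<^sup>2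
           / ((bary v x n + bary v x l) * (bary v x n + bary v x m)))"

definition Z3_e :: "(4 \<Rightarrow> real^3) \<Rightarrow> (real^3 \<Rightarrow> real) set" where
  "Z3_e v = {y + w | y w. y \<in> Z3_0 v \<and>
     w \<in> span {edge_bubble v l m n | l m n. l < m \<and> n \<notin> {l, m}}}"

text \<open>
  The functions \<open>\<Phi>\<close> as formulas in barycentric coordinates \<open>\<mu>\<close>.  They ignore the coordinate with
  index \<open>i\<close>, where \<open>i\<close> is the index different from \<open>l\<close>, \<open>m\<close>, \<open>n\<close>.
\<close>

definition Phi_l :: "4 \<Rightarrow> 4 \<Rightarrow> 4 \<Rightarrow> (4 \<Rightarrow> real) \<Rightarrow> real" where
  "Phi_l l m n \<mu> = \<mu> n * \<mu> l * (\<mu> m)\<^sup>2 * (2 * \<mu> n + \<mu> l) / ((\<mu> n + \<mu> l)\<^sup>2 * (\<mu> n + \<mu> m))"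

definition Phi_m :: "4 \<Rightarrow> 4 \<Rightarrow> 4 \<Rightarrow> (4 \<Rightarrow> real) \<Rightarrow> real" where
  "Phi_m l m n \<mu> = \<mu> n * (\<mu> l)\<^sup>2 * \<mu> m * (2 * \<mu> n + \<mu> m) / ((\<mu> n + \<mu> l) * (\<mu> n + \<mu> m)\<^sup>2)"

definition Phi_n :: "4 \<Rightarrow> 4 \<Rightarrow> 4 \<Rightarrow> (4 \<Rightarrow> real) \<Rightarrow> real" where
  "Phi_n l m n \<mu> = (\<mu> l)\<^sup>2 * (\<mu> m)\<^sup>2 * (\<mu> l * \<mu> m - (\<mu> n)\<^sup>2)
      / ((\<mu> n + \<mu> l)\<^sup>2 * (\<mu> n + \<mu> m)\<^sup>2) - \<mu> l * \<mu> m"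

text \<open>
  The condition \<open>{i, l, m, n} = UNIV\<close> says that \<open>[v\<^sub>l, v\<^sub>m]\<close> is an edge of the face \<open>f\<^sub>i\<close> and \<open>n\<close> is the
  remaining index.
\<close>

definition Phi_forms :: "4 \<Rightarrow> ((4 \<Rightarrow> real) \<Rightarrow> real) set" where
  "Phi_forms i = span (\<Union>{{Phi_l l m n, Phi_m l m n, Phi_n l m n} | l m n.
                          l < m \<and> {i, l, m, n} = UNIV})"

text \<open>
  On the face, the denominators vanish only at vertices; there the convention \<open>x / 0 = 0\<close> gives the
  value \<open>0\<close>, which is also the continuous extension of each \<open>\<Phi>\<close>.
\<close>

definition Q_edge :: "(4 \<Rightarrow> real^3) \<Rightarrow> 4 \<Rightarrow> (real^3 \<Rightarrow> real) set" where
  "Q_edge v i = {on_set (face v i) (\<lambda>x. F (bary v x)) | F. F \<in> Phi_forms i}"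

text \<open>
  Different formulas may represent the same \<open>q\<close>; the extension does not depend on the choice, since
  all \<open>\<Phi>\<close> are homogeneous of degree 2.
\<close>

definition bary_extension :: "(4 \<Rightarrow> real^3) \<Rightarrow> 4 \<Rightarrow> (real^3 \<Rightarrow> real) \<Rightarrow> real^3 \<Rightarrow> real" where
  "bary_extension v i q = (THE g. \<exists>F\<in>Phi_forms i.
      q = on_set (face v i) (\<lambda>x. F (bary v x)) \<and>
      g = on_set (interior (tetrahedron v)) (\<lambda>x. F (bary v x)))"

definition normal_lift :: "(4 \<Rightarrow> real^3) \<Rightarrow> 4 \<Rightarrow> (real^3 \<Rightarrow> real) \<Rightarrow> real^3 \<Rightarrow> real" where
  "normal_lift v i q = on_set (interior (tetrahedron v))
     (\<lambda>x. bary v x i / dcoef v i i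
           * (\<Prod>j\<in>UNIV - {i}. bary v x j / (bary v x i + bary v x j))
           * bary_extension v i q x)"

definition boundary_value ::
    "(4 \<Rightarrow> real^3) \<Rightarrow> (real^3 \<Rightarrow> 'a::t2_space) \<Rightarrow> real^3 \<Rightarrow> 'a" where
  "boundary_value v f x = Lim (at x within interior (tetrahedron v)) f"

definition normal_trace :: "(4 \<Rightarrow> real^3) \<Rightarrow> 4 \<Rightarrow> (real^3 \<Rightarrow> real) \<Rightarrow> real^3 \<Rightarrow> real" where
  "normal_trace v i z =
     on_set (face v i) (\<lambda>x. boundary_value v (\<lambda>y. grad z y \<bullet> outer_normal v i) x)"

definition q_part :: "(4 \<Rightarrow> real^3) \<Rightarrow> 4 \<Rightarrow> (real^3 \<Rightarrow> real) \<Rightarrow> real^3 \<Rightarrow> real" where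
  "q_part v i z = (THE q. q \<in> Q_edge v i \<and>
      (\<exists>p\<in>polys_on (face v i) 2. normal_trace v i z = p + q))"

definition R_T :: "(4 \<Rightarrow> real^3) \<Rightarrow> (real^3 \<Rightarrow> real) \<Rightarrow> real^3 \<Rightarrow> real" where
  "R_T v z = z - (\<Sum>i\<in>UNIV. normal_lift v i (q_part v i z))"

definition Z3_sing :: "(4 \<Rightarrow> real^3) \<Rightarrow> (real^3 \<Rightarrow> real) set" where
  "Z3_sing v = R_T v ` Z3_e v"

definition Z3_red :: "(4 \<Rightarrow> real^3) \<Rightarrow> (real^3 \<Rightarrow> real) set" where
  "Z3_red v = {z \<in> Z3_sing v. \<forall>i. normal_trace v i z \<in> polys_on (face v i) 1}"

text \<open>The 16 vertex degrees of freedom: a value and a gradient at each of the four vertices.\<close>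

definition hermite_dofs :: "(4 \<Rightarrow> real^3) \<Rightarrow> (real^3 \<Rightarrow> real) \<Rightarrow> (real \<times> (real^3))^4" where
  "hermite_dofs v z = (\<chi> i. (boundary_value v z (v i), boundary_value v (grad z) (v i)))"

end

theory Submission
  imports Defs
begin

text \<open>
Write \<open>\<lambda>\<^sub>j\<close> for the barycentric coordinates and \<open>g\<^sub>j\<close> for their gradients.  The enriched space is spanned by
sixteen polynomials and twelve bubbles.  The polynomials are
\<open>N\<^sub>i\<^sub>j = (\<lambda>\<^sub>i\<lambda>\<^sub>j + \<lambda>\<^sub>i\<^sup>2\<lambda>\<^sub>j - \<lambda>\<^sub>j\<^sup>2\<lambda>\<^sub>i) / 2\<close> for all ordered pairs, \<open>i = j\<close> included; they are chosen because
\<open>\<nabla>N\<^sub>i\<^sub>j(v\<^sub>k)\<close> is \<open>g\<^sub>j\<close> if \<open>i = k\<close> and \<open>0\<close> otherwise, while \<open>N\<^sub>i\<^sub>j(v\<^sub>k)\<close> is \<open>1/2\<close> if \<open>i = j = k\<close> and \<open>0\<close>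
otherwise.  The bubbles have zero value and zero gradient at every vertex.  So if \<open>\<beta>\<^sub>i\<^sub>j\<close> and \<open>c\<^sub>t\<close> are
the coefficients of a function, then its vertex data at \<open>v\<^sub>i\<close> are \<open>\<beta>\<^sub>i\<^sub>i / 2\<close> and \<open>\<Sum>\<^sub>j \<beta>\<^sub>i\<^sub>j g\<^sub>j\<close>.  The only
linear relation between the \<open>g\<^sub>j\<close> is that their sum vanishes, hence prescribing the data amounts to
prescribing \<open>\<beta>\<close> (\<open>gradient_expansion\<close>, \<open>gradient_coeff_unique\<close>).

It remains to see that the condition on the normal derivatives picks exactly one \<open>c\<close> for each \<open>\<beta>\<close>.
On a face, the normal derivative is the sum of a quadratic polynomial and an element of the span of
the \<open>\<Phi>\<close>.  This splitting is unique: all \<open>\<Phi>\<close> vanish on the edges of the face, and a quadratic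
polynomial that vanishes at the midpoints and end points of these edges vanishes on the face
(\<open>quadratic_zero_on_face\<close>).  The lift of \<open>q\<close> from the face \<open>f\<^sub>i\<close> has normal derivative \<open>q\<close> on \<open>f\<^sub>i\<close>
and \<open>0\<close> on the other faces, and zero vertex data (\<open>lift_jet\<close>).  So the correction removes the
\<open>\<Phi>\<close>-parts and changes neither the polynomial parts nor the vertex data (\<open>normal_trace_corrected\<close>,
\<open>hermite_dofs_corrected\<close>).

On \<open>f\<^sub>i\<close> the quadratic polynomials are the direct sum of the affine ones and the span of the products
\<open>\<lambda>\<^sub>l\<lambda>\<^sub>m\<close> over the three edges (\<open>reducible_polys2\<close>, \<open>edge_sum_affine_imp_zero\<close>).  The bubble
\<open>E\<^sub>l\<^sub>m\<^sup>n\<close>, with \<open>i\<close> the fourth index, contributes to the coefficient of \<open>\<lambda>\<^sub>l\<lambda>\<^sub>m\<close> the number \<open>d\<^sub>n\<^sub>i\<close> on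
\<open>f\<^sub>i\<close> and \<open>d\<^sub>n\<^sub>n\<close> on \<open>f\<^sub>n\<close>, and nothing else.  The demand that all traces be affine therefore
decouples into one linear system for each edge \<open>[v\<^sub>l, v\<^sub>m]\<close>: two equations, from the faces \<open>f\<^sub>i\<close> and
\<open>f\<^sub>n\<close>, for the coefficients of \<open>E\<^sub>l\<^sub>m\<^sup>n\<close> and \<open>E\<^sub>l\<^sub>m\<^sup>i\<close>.  Its determinant is, up to a positive factor,
\<open>(g\<^sub>i \<bullet> g\<^sub>n)\<^sup>2 - |g\<^sub>i|\<^sup>2 |g\<^sub>n|\<^sup>2\<close>, which is not zero because \<open>g\<^sub>i\<close> and \<open>g\<^sub>n\<close> are not parallel
(\<open>dcoef_det_nonzero\<close>).

The analysis consists in showing that the limits at the boundary exist where denominators vanish.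
The \<open>\<Phi>\<close> are polynomials in the coordinates and the ratios \<open>\<lambda>\<^sub>l / (\<lambda>\<^sub>n + \<lambda>\<^sub>l)\<close>.  These ratios are
bounded but have unbounded gradients; after multiplication by \<open>\<lambda>\<^sub>n\<close> or \<open>\<lambda>\<^sub>l\<close> the gradients become
bounded.  The predicate \<open>weighted\<close> keeps track of this, and shows that the \<open>\<Phi>\<close> have
bounded gradients and that the gradient of a lift has limits on the whole boundary.
\<close>

section \<open>Index combinatorics, functions on a set, gradients\<close>

lemma ex_index_outside_pair: "\<exists>k::4. k \<noteq> i \<and> k \<noteq> j"
proof (rule ccontr)
  assume "\<not> ?thesis"
  then have "(UNIV::4 set) \<subseteq> {i, j}" by auto
  then have "card (UNIV::4 set) \<le> card {i, j}" by (rule card_mono[rotated]) simp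
  also have "\<dots> \<le> 2" by (simp add: card_insert_if)
  finally show False by simp
qed

lemma four_indices_distinct:
  assumes "{i, l, m, n} = (UNIV :: 4 set)"
  shows "distinct [i, l, m, n]"
proof (rule card_distinct)
  have "card (set [i, l, m, n]) = card (UNIV :: 4 set)" using assms by simp
  then show "card (set [i, l, m, n]) = length [i, l, m, n]" by simp
qed

lemma complete_indices:
  assumes "distinct [i, j, k :: 4]"
  obtains n where "{i, j, k, n} = UNIV"
proof -
  have "card {i, j, k} = 3" using distinct_card[OF assms] by simp
  then have "card (UNIV - {i, j, k}) = 1" by (simp add: card_Diff_subset)
  then obtain n where "UNIV - {i, j, k} = {n}" by (rule card_1_singletonE)
  then show thesis by (intro that[of n]) auto
qed

lemma sum_delta_pair: "(\<Sum>p\<in>(UNIV::('p::finite) set). \<beta> p * (if p = q then a else 0)) = \<beta> q * (a::real)"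
  by (simp add: if_distrib[of "\<lambda>t. _ * t"] cong: if_cong)

lemma sum_pairs: "(\<Sum>p\<in>(UNIV::(4 \<times> 4) set). f p) = (\<Sum>i\<in>UNIV. \<Sum>j\<in>UNIV. f (i, j))"
  by (simp add: sum.cartesian_product)

lemma on_set_add: "on_set S f + on_set S g = on_set S (\<lambda>x. f x + g x)"
  by (auto simp: on_set_def fun_eq_iff)

lemma on_set_diff: "on_set S f - on_set S g = on_set S (\<lambda>x. f x - g x)"
  by (auto simp: on_set_def fun_eq_iff)

lemma on_set_scale: "c *\<^sub>R on_set S f = on_set S (\<lambda>x. c * f x)"
  by (auto simp: on_set_def fun_eq_iff scaleR_fun_def)

lemma on_set_0: "on_set S (\<lambda>x. 0) = 0"
  by (auto simp: on_set_def fun_eq_iff)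

lemma on_set_cong: "(\<And>x. x \<in> S \<Longrightarrow> f x = g x) \<Longrightarrow> on_set S f = on_set S g"
  by (auto simp: on_set_def fun_eq_iff)

lemma on_set_eqD: "on_set S f = on_set S g \<Longrightarrow> x \<in> S \<Longrightarrow> f x = g x"
  by (auto simp: on_set_def fun_eq_iff split: if_splits)

lemma sum_fun_apply: "(\<Sum>t\<in>A. f t) x = (\<Sum>t\<in>A. f t x)" for f :: "'t \<Rightarrow> 'a \<Rightarrow> 'b::comm_monoid_add"
  by (induction A rule: infinite_finite_induct) auto

lemma on_set_sum: "(\<Sum>t\<in>A. on_set S (f t)) = on_set S (\<lambda>x. \<Sum>t\<in>A. f t x)"
  by (auto simp: on_set_def fun_eq_iff sum_fun_apply)

lemma GDERIV_unique:
  fixes f :: "real^3 \<Rightarrow> real"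
  assumes "GDERIV f x :> D" "GDERIV f x :> E"
  shows "D = E"
proof -
  have "(\<lambda>h. h \<bullet> D) = (\<lambda>h. h \<bullet> E)"
    using has_derivative_unique assms unfolding gderiv_def by blast
  then have "\<forall>h. h \<bullet> D = h \<bullet> E" by meson
  then show ?thesis by (metis vector_eq_ldot)
qed

lemma grad_eq:
  assumes "GDERIV f x :> D"
  shows "grad f x = D"
  unfolding grad_def by (rule the_equality) (use assms GDERIV_unique in blast)+

lemma GDERIV_grad: "GDERIV z x :> D \<Longrightarrow> GDERIV z x :> grad z x"
  using grad_eq by metis

section \<open>Barycentric coordinates\<close>

text \<open>Inside the locale, \<open>L x j\<close> is \<open>\<lambda>\<^sub>j(x)\<close>, \<open>I\<close> is the open tetrahedron and \<open>g j\<close> is the gradient of \<open>\<lambda>\<^sub>j\<close>.\<close>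

locale tetra =
  fixes v :: "4 \<Rightarrow> real^3"
  assumes nondeg: "nondegenerate v"
begin

abbreviation T where "T \<equiv> tetrahedron v"
abbreviation I where "I \<equiv> interior (tetrahedron v)"
abbreviation L where "L \<equiv> bary v"

lemma inj_v: "inj v"
  using nondeg by (simp add: nondegenerate_def)

lemma sum_range_v: "sum f (range v) = (\<Sum>j\<in>UNIV. f (v j))"
  by (subst sum.reindex[OF inj_v]) simp

lemma v_independent:
  assumes "(\<Sum>j\<in>UNIV. a j) = 0" "(\<Sum>j\<in>UNIV. a j *\<^sub>R v j) = 0"
  shows "a j = 0"
proof -
  define U where "U y = a (inv v y)" for y
  have U: "U (v j) = a j" for j by (simp add: U_def inj_v)
  have "\<not> affine_dependent (range v)" using nondeg by (simp add: nondegenerate_def)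
  then have "\<not> (\<exists>U. sum U (range v) = 0 \<and> (\<exists>v\<in>range v. U v \<noteq> 0) \<and> sum (\<lambda>v. U v *\<^sub>R v) (range v) = 0)"
    by (simp add: affine_dependent_explicit_finite)
  moreover have "sum U (range v) = 0" "sum (\<lambda>v. U v *\<^sub>R v) (range v) = 0"
    using assms by (simp_all add: sum_range_v U)
  ultimately have "\<forall>y\<in>range v. U y = 0" by blast
  then show ?thesis by (metis U rangeI)
qed

lemma card_range_v: "card (range v) = Suc DIM(real^3)"
  by (simp add: card_image[OF inj_v])

lemma bary_exists: "\<exists>a. (\<Sum>j\<in>UNIV. a j) = 1 \<and> (\<Sum>j\<in>UNIV. a j *\<^sub>R v j) = x"
proof -
  have "affine hull (range v) = UNIV"
    using affine_independent_span_eq[OF _ card_range_v] nondeg by (simp add: nondegenerate_def)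
  then have "x \<in> affine hull (range v)" by simp
  then obtain u where "sum u (range v) = 1" "sum (\<lambda>v. u v *\<^sub>R v) (range v) = x"
    by (auto simp: affine_hull_finite)
  then show ?thesis by (intro exI[of _ "\<lambda>j. u (v j)"]) (simp add: sum_range_v)
qed

lemma bary_unique:
  assumes "(\<Sum>j\<in>UNIV. a j) = 1" "(\<Sum>j\<in>UNIV. a j *\<^sub>R v j) = x"
    "(\<Sum>j\<in>UNIV. b j) = 1" "(\<Sum>j\<in>UNIV. b j *\<^sub>R v j) = x"
  shows "a = b"
proof
  fix j
  have "a j - b j = 0"
    by (rule v_independent) (simp_all add: assms sum_subtractf scaleR_left_diff_distrib)
  then show "a j = b j" by simp
qed

lemma bary_props: "(\<Sum>j\<in>UNIV. L x j) = 1" "(\<Sum>j\<in>UNIV. L x j *\<^sub>R v j) = x"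
proof -
  have "\<exists>!a. (\<Sum>j\<in>UNIV. a j) = 1 \<and> (\<Sum>j\<in>UNIV. a j *\<^sub>R v j) = x"
    using bary_exists[of x] bary_unique by blast
  from theI'[OF this] show "(\<Sum>j\<in>UNIV. L x j) = 1" "(\<Sum>j\<in>UNIV. L x j *\<^sub>R v j) = x"
    by (auto simp: bary_def)
qed

lemma bary_eqI:
  assumes "(\<Sum>j\<in>UNIV. a j) = 1" "(\<Sum>j\<in>UNIV. a j *\<^sub>R v j) = x"
  shows "L x = a"
  using bary_unique[OF bary_props assms] .

lemma bary_combination:
  assumes "(\<Sum>j\<in>UNIV. a j) = 1"
  shows "L (\<Sum>j\<in>UNIV. a j *\<^sub>R v j) = a"
  using bary_eqI[OF assms] by simp

lemma bary_vertex: "L (v i) j = (if j = i then 1 else 0)"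
proof -
  have "L (v i) = (\<lambda>j. if j = i then 1 else 0)"
    by (rule bary_eqI) (simp_all add: if_distrib[of "\<lambda>c. c *\<^sub>R _"] cong: if_cong)
  then show ?thesis by simp
qed

text \<open>Uniqueness of barycentric coordinates turns affine relations between points into relations between
their coordinates; this avoids any explicit inverse matrix.\<close>

lemma bary_linear: "linear (\<lambda>x. L x j - L 0 j)"
proof (rule linearI)
  fix x y
  have "L (x + y) = (\<lambda>j. L x j + L y j - L 0 j)"
    by (rule bary_eqI) (simp_all add: sum.distrib sum_subtractf scaleR_left_diff_distrib scaleR_left_distrib bary_props)
  then show "L (x + y) j - L 0 j = L x j - L 0 j + (L y j - L 0 j)" by simp
next
  fix c x
  have *: "(\<Sum>j\<in>UNIV. (c * L x j) *\<^sub>R v j) = c *\<^sub>R x" "(\<Sum>j\<in>UNIV. (c * L 0 j) *\<^sub>R v j) = 0"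
    using bary_props(2)[of x] bary_props(2)[of 0] 
    by (simp_all add: scaleR_scaleR[symmetric] scaleR_right.sum[symmetric] del: scaleR_scaleR)
  have "L (c *\<^sub>R x) = (\<lambda>j. c * L x j + (L 0 j - c * L 0 j))"
    by (rule bary_eqI) (simp_all add: sum.distrib sum_subtractf scaleR_left_diff_distrib
        scaleR_left_distrib bary_props * flip: sum_distrib_left)
  then show "L (c *\<^sub>R x) j - L 0 j = c *\<^sub>R (L x j - L 0 j)" by (simp add: algebra_simps)
qed

definition g :: "4 \<Rightarrow> real^3" where "g j = adjoint (\<lambda>x. L x j - L 0 j) 1"

lemma bary_affine: "L x j = L y j + g j \<bullet> (x - y)"
proof -
  have "L x j - L 0 j = g j \<bullet> x" for x
    using adjoint_works[OF bary_linear, of x j 1] by (simp add: g_def inner_commute)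
  from this[of x] this[of y] show ?thesis by (simp add: inner_diff_right)
qed

lemma g_diff: "g j \<bullet> (x - y) = L x j - L y j"
  using bary_affine[of x j y] by simp

lemma GDERIV_bary: "GDERIV (\<lambda>x. L x j) x :> g j"
proof -
  have "(\<lambda>x. L x j) = (\<lambda>x. L 0 j + g j \<bullet> x)"
  proof
    show "L x j = L 0 j + g j \<bullet> x" for x using bary_affine[of x j 0] by simp
  qed
  then show ?thesis
    unfolding gderiv_def by (auto intro!: derivative_eq_intros simp: inner_commute)
qed

lemma bary_tendsto [tendsto_intros]: "((\<lambda>y. L y j) \<longlongrightarrow> L x j) (at x within S)"
proof -
  have "((\<lambda>y. L x j + g j \<bullet> (y - x)) \<longlongrightarrow> L x j + g j \<bullet> (x - x)) (at x within S)"
    by (intro tendsto_intros)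
  then show ?thesis by (subst bary_affine[of _ j x]) simp
qed

lemma T_iff: "x \<in> T \<longleftrightarrow> (\<forall>j. 0 \<le> L x j)"
proof
  assume "x \<in> T"
  then obtain u where u: "\<forall>x\<in>range v. 0 \<le> u x" "sum u (range v) = 1" "sum (\<lambda>x. u x *\<^sub>R x) (range v) = x"
    by (auto simp: tetrahedron_def convex_hull_finite)
  have "L x = (\<lambda>j. u (v j))"
    by (rule bary_eqI) (use u in \<open>simp_all add: sum_range_v\<close>)
  then show "\<forall>j. 0 \<le> L x j" using u by simp
next
  assume *: "\<forall>j. 0 \<le> L x j"
  have "(\<Sum>j\<in>UNIV. L x j *\<^sub>R v j) \<in> T"
    unfolding tetrahedron_def
    by (rule convex_sum) (auto simp: * bary_props hull_inc)
  then show "x \<in> T" by (simp add: bary_props)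
qed

lemma I_iff: "x \<in> I \<longleftrightarrow> (\<forall>j. 0 < L x j)"
proof
  assume "x \<in> I"
  then obtain u where u: "\<forall>x\<in>range v. 0 < u x" "sum u (range v) = 1" "sum (\<lambda>x. u x *\<^sub>R x) (range v) = x"
    using interior_convex_hull_explicit_minimal[of "range v"] nondeg card_range_v
    by (auto simp: tetrahedron_def nondegenerate_def)
  have "L x = (\<lambda>j. u (v j))"
    by (rule bary_eqI) (use u in \<open>simp_all add: sum_range_v\<close>)
  then show "\<forall>j. 0 < L x j" using u by simp
next
  assume *: "\<forall>j. 0 < L x j"
  have "(\<Sum>y\<in>range v. L x (inv v y)) = 1" "(\<Sum>y\<in>range v. L x (inv v y) *\<^sub>R y) = x"
    by (simp_all add: sum_range_v inj_v bary_props)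
  then show "x \<in> I"
    using interior_convex_hull_explicit_minimal[of "range v"] nondeg card_range_v *
    by (auto simp: tetrahedron_def nondegenerate_def intro!: exI[of _ "\<lambda>y. L x (inv v y)"])
qed

lemma bary_le_1: "x \<in> T \<Longrightarrow> L x j \<le> 1"
  using member_le_sum[of j UNIV "L x"] by (simp add: T_iff bary_props)

lemma I_subset_T: "x \<in> I \<Longrightarrow> x \<in> T"
  using interior_subset by blast

lemma at_I_nontrivial:
  assumes "x \<in> T"
  shows "at x within I \<noteq> bot"
proof -
  define c where "c = (\<Sum>j\<in>UNIV. (1/4::real) *\<^sub>R v j)"
  have "L c = (\<lambda>_. 1/4)" unfolding c_def by (rule bary_combination) simp
  then have cI: "c \<in> I" by (simp add: I_iff)
  have "x islimpt I"
  proof (cases "x \<in> I")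
    case True
    then show ?thesis by (simp add: open_imp_islimpt interior_limit_point)
  next
    case False
    have "closure I = closure T"
      using convex_closure_interior[of T] cI by (auto simp: tetrahedron_def convex_convex_hull)
    then have "x \<in> closure I" using assms closure_subset by blast
    then show ?thesis using False by (simp add: closure_def)
  qed
  then show ?thesis by (simp add: trivial_limit_within)
qed

definition boundary :: "(real^3) set" where "boundary = (\<Union>i. face v i)"

lemma boundary_T: "x \<in> boundary \<Longrightarrow> x \<in> T" by (auto simp: boundary_def face_def)

lemma vertex_face: "i \<noteq> k \<Longrightarrow> v i \<in> face v k"
  by (simp add: face_def T_iff bary_vertex)

end

section \<open>Outer normals and boundary limits\<close>

context tetra
begin

text \<open>The edges at a vertex span the space, since \<open>w\<close> is the combination of the edges \<open>v\<^sub>j - v\<^sub>k\<close> with the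
barycentric coordinates of \<open>w + v\<^sub>k\<close> as coefficients.\<close>

lemma zero_if_orthogonal_to_edges:
  assumes "\<And>j. u \<bullet> (v j - v k) = 0"
  shows "u = 0"
proof -
  have "u \<bullet> w = 0" for w
  proof -
    have "w = (\<Sum>j\<in>UNIV. L (w + v k) j *\<^sub>R v j) - (\<Sum>j\<in>UNIV. L (w + v k) j) *\<^sub>R v k"
      by (simp add: bary_props)
    also have "\<dots> = (\<Sum>j\<in>UNIV. L (w + v k) j *\<^sub>R (v j - v k))"
      by (simp add: scaleR_right_diff_distrib sum_subtractf scaleR_sum_left)
    finally have "u \<bullet> w = u \<bullet> (\<Sum>j\<in>UNIV. L (w + v k) j *\<^sub>R (v j - v k))" by simp
    then show ?thesis by (simp add: inner_sum_right assms)
  qed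
  then show ?thesis using inner_eq_zero_iff by blast
qed

lemma g_edge: "g j \<bullet> (v i - v k) = (if j = i then 1 else 0) - (if j = k then 1 else 0)"
  by (simp add: g_diff bary_vertex)

lemma g_nonzero: "g i \<noteq> 0"
proof
  assume "g i = 0"
  moreover obtain k where "k \<noteq> i" using ex_index_outside_pair by blast
  ultimately show False using g_edge[of i i k] by simp
qed

text \<open>For uniqueness, a vector orthogonal to the face minus a suitable multiple of \<open>g\<^sub>i\<close> is orthogonal to all
edges at a vertex of the face, hence zero.\<close>

lemma outer_normal_eq: "outer_normal v i = - (1 / norm (g i)) *\<^sub>R g i"
  unfolding outer_normal_def
proof (rule the_equality, intro conjI ballI)
  let ?\<nu> = "- (1 / norm (g i)) *\<^sub>R g i"
  show "norm ?\<nu> = 1" using g_nonzero by simp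
  show "?\<nu> \<bullet> (x - y) = 0" if "x \<in> face v i" "y \<in> face v i" for x y
    using that by (simp add: face_def g_diff)
  show "?\<nu> \<bullet> (v i - x) < 0" if "x \<in> face v i" for x
    using that g_nonzero by (simp add: face_def g_diff bary_vertex)
next
  fix \<nu> :: "real^3"
  assume \<nu>: "norm \<nu> = 1 \<and> (\<forall>x\<in>face v i. \<forall>y\<in>face v i. \<nu> \<bullet> (x - y) = 0)
      \<and> (\<forall>x\<in>face v i. \<nu> \<bullet> (v i - x) < 0)"
  obtain k where k: "k \<noteq> i" using ex_index_outside_pair by blast
  \<comment> \<open>The factor by which \<open>\<nu>\<close> exceeds \<open>g\<^sub>i\<close>, since \<open>g\<^sub>i \<bullet> (v\<^sub>i - v\<^sub>k) = 1\<close>; it is negative as \<open>\<nu>\<close> points outwards.\<close>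
  define c where "c = \<nu> \<bullet> (v i - v k)"
  have "c < 0" using \<nu> vertex_face[OF k] by (simp add: c_def)
  have "\<nu> - c *\<^sub>R g i = 0"
  proof (rule zero_if_orthogonal_to_edges)
    fix j
    show "(\<nu> - c *\<^sub>R g i) \<bullet> (v j - v k) = 0"
    proof (cases "j = i")
      case True
      then show ?thesis using k by (simp add: inner_diff_left[of \<nu>] g_edge c_def)
    next
      case False
      then have "\<nu> \<bullet> (v j - v k) = 0" using \<nu> vertex_face k by blast
      then show ?thesis using False k by (simp add: inner_diff_left[of \<nu>] g_edge)
    qed
  qed
  then have eq: "\<nu> = c *\<^sub>R g i" by simp
  then have "\<bar>c\<bar> * norm (g i) = 1" using \<nu> by simp
  then have "c = - (1 / norm (g i))" using \<open>c < 0\<close> g_nonzero by (simp add: field_simps)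
  then show "\<nu> = - (1 / norm (g i)) *\<^sub>R g i" using eq by simp
qed

lemma dcoef_normal: "dcoef v j i = g j \<bullet> outer_normal v i"
  by (simp add: dcoef_def grad_eq[OF GDERIV_bary])

lemma dcoef_diag: "dcoef v i i = - norm (g i)"
  using g_nonzero by (simp add: dcoef_normal outer_normal_eq dot_square_norm power2_eq_square)

lemma dcoef_diag_nonzero: "dcoef v i i \<noteq> 0"
  using g_nonzero by (simp add: dcoef_diag)

text \<open>Equality in the Cauchy-Schwarz inequality would make \<open>g\<^sub>i\<close> and \<open>g\<^sub>n\<close> parallel, but along an edge from a
third vertex to \<open>v\<^sub>i\<close> only \<open>\<lambda>\<^sub>i\<close> changes.\<close>

lemma dcoef_det_nonzero:
  assumes "i \<noteq> n"
  shows "dcoef v n i * dcoef v i n - dcoef v i i * dcoef v n n \<noteq> 0"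
proof
  assume "dcoef v n i * dcoef v i n - dcoef v i i * dcoef v n n = 0"
  then have "(g i \<bullet> g n)\<^sup>2 = (norm (g i) * norm (g n))\<^sup>2"
    using g_nonzero[of i] g_nonzero[of n]
    by (simp add: dcoef_diag) (simp add: dcoef_normal outer_normal_eq field_simps power2_eq_square inner_commute)
  then have "\<bar>g i \<bullet> g n\<bar> = norm (g i) * norm (g n)"
    by (metis abs_of_nonneg mult_nonneg_nonneg norm_ge_zero power2_eq_iff_nonneg abs_ge_zero power2_abs)
  then have par: "norm (g i) *\<^sub>R g n = norm (g n) *\<^sub>R g i \<or> norm (g i) *\<^sub>R g n = - norm (g n) *\<^sub>R g i"
    by (simp add: norm_cauchy_schwarz_abs_eq)
  obtain k where k: "k \<noteq> i" "k \<noteq> n" using ex_index_outside_pair by blast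
  have "norm (g n) = 0"
    using par
  proof
    assume "norm (g i) *\<^sub>R g n = norm (g n) *\<^sub>R g i"
    then have "(norm (g i) *\<^sub>R g n) \<bullet> (v i - v k) = (norm (g n) *\<^sub>R g i) \<bullet> (v i - v k)" by simp
    then show ?thesis using k assms by (simp add: g_edge)
  next
    assume "norm (g i) *\<^sub>R g n = - norm (g n) *\<^sub>R g i"
    then have "(norm (g i) *\<^sub>R g n) \<bullet> (v i - v k) = (- norm (g n) *\<^sub>R g i) \<bullet> (v i - v k)" by simp
    then show ?thesis using k assms by (simp add: g_edge)
  qed
  then show False using g_nonzero by simp
qed

text \<open>All boundary data of a function on the open tetrahedron that enter the theorem: vertex values \<open>a\<close>
and boundary gradients \<open>h\<close>.  Jets add and scale, so they can be computed for generators.\<close>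

definition jet where
  "jet z a h \<longleftrightarrow> (\<forall>x\<in>I. \<exists>D. GDERIV z x :> D)
     \<and> (\<forall>i. (z \<longlongrightarrow> a i) (at (v i) within I))
     \<and> (\<forall>x\<in>boundary. (grad z \<longlongrightarrow> h x) (at x within I))"

lemma tendsto_cong_I:
  assumes "\<And>y. y \<in> I \<Longrightarrow> f y = f' y"
  shows "(f \<longlongrightarrow> l) (at x within I) \<longleftrightarrow> (f' \<longlongrightarrow> l) (at x within I)"
  by (rule tendsto_cong) (simp add: eventually_at_filter assms)

lemma GDERIV_on_set:
  assumes "GDERIV f x :> D" "x \<in> I"
  shows "GDERIV (on_set I f) x :> D"
  using assms unfolding gderiv_def
  by (rule has_derivative_transform_within_open[OF _ open_interior]) (auto simp: on_set_def assms)

lemma jetI: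
  assumes "\<And>x. x \<in> I \<Longrightarrow> GDERIV f x :> D x"
    and "\<And>i. (f \<longlongrightarrow> a i) (at (v i) within I)"
    and "\<And>x. x \<in> boundary \<Longrightarrow> (D \<longlongrightarrow> h x) (at x within I)"
  shows "jet (on_set I f) a h"
proof -
  have 1: "(on_set I f \<longlongrightarrow> a i) (at (v i) within I)" for i
    using assms(2)[of i] by (subst tendsto_cong_I[of _ f]) (auto simp: on_set_def)
  have 2: "(grad (on_set I f) \<longlongrightarrow> h x) (at x within I)" if "x \<in> boundary" for x
    using assms(3)[OF that]
    by (subst tendsto_cong_I[of _ D]) (auto intro!: grad_eq GDERIV_on_set assms(1))
  show ?thesis unfolding jet_def using 1 2 GDERIV_on_set[OF assms(1)] by blast
qed

lemma jet_GDERIV: "jet z a h \<Longrightarrow> x \<in> I \<Longrightarrow> GDERIV z x :> grad z x"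
  unfolding jet_def by (meson GDERIV_grad)

lemma jet_add:
  assumes "jet y a h" "jet z b k"
  shows "jet (y + z) (\<lambda>i. a i + b i) (\<lambda>x. h x + k x)"
proof -
  have D: "GDERIV (y + z) x :> grad y x + grad z x" if "x \<in> I" for x
    unfolding plus_fun_def
    by (intro GDERIV_add jet_GDERIV[OF assms(1) that] jet_GDERIV[OF assms(2) that])
  have "(grad (y + z) \<longlongrightarrow> h x + k x) (at x within I)" if "x \<in> boundary" for x
    using that assms
    by (subst tendsto_cong_I[of _ "\<lambda>x. grad y x + grad z x"])
      (auto intro!: grad_eq D tendsto_intros simp: jet_def)
  moreover have "((y + z) \<longlongrightarrow> a i + b i) (at (v i) within I)" for i
    unfolding plus_fun_def using assms by (auto intro!: tendsto_intros simp: jet_def)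
  ultimately show ?thesis unfolding jet_def using D by blast
qed

lemma jet_scale:
  assumes "jet z a h"
  shows "jet (c *\<^sub>R z) (\<lambda>i. c * a i) (\<lambda>x. c *\<^sub>R h x)"
proof -
  have D: "GDERIV (c *\<^sub>R z) x :> c *\<^sub>R grad z x" if "x \<in> I" for x
  proof -
    have "GDERIV z x :> grad z x"
      using jet_GDERIV[OF assms that] .
    from GDERIV_mult[OF GDERIV_const[of c] this] show ?thesis
      by (simp add: scaleR_fun_def)
  qed
  have "(grad (c *\<^sub>R z) \<longlongrightarrow> c *\<^sub>R h x) (at x within I)" if "x \<in> boundary" for x
    using that assms
    by (subst tendsto_cong_I[of _ "\<lambda>x. c *\<^sub>R grad z x"])
      (auto intro!: grad_eq D tendsto_intros simp: jet_def)
  moreover have "((c *\<^sub>R z) \<longlongrightarrow> c * a i) (at (v i) within I)" for i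
    unfolding scaleR_fun_def real_scaleR_def using assms by (auto intro!: tendsto_intros simp: jet_def)
  ultimately show ?thesis unfolding jet_def using D by blast
qed

lemma jet_zero: "jet 0 (\<lambda>i. 0) (\<lambda>x. 0)"
proof -
  have "jet (on_set I (\<lambda>x. 0)) (\<lambda>i. 0) (\<lambda>x. 0)"
    by (rule jetI[where D = "\<lambda>x. 0"]) (auto intro: GDERIV_const)
  then show ?thesis unfolding on_set_0 .
qed

lemma jet_sum:
  assumes "finite A" "\<And>t. t \<in> A \<Longrightarrow> jet (z t) (a t) (h t)"
  shows "jet (\<Sum>t\<in>A. z t) (\<lambda>i. \<Sum>t\<in>A. a t i) (\<lambda>x. \<Sum>t\<in>A. h t x)"
  using assms
proof (induction A rule: finite_induct)
  case empty
  show ?case unfolding sum.empty by (rule jet_zero)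
next
  case (insert t A)
  then have "jet (z t + (\<Sum>t\<in>A. z t)) (\<lambda>i. a t i + (\<Sum>t\<in>A. a t i)) (\<lambda>x. h t x + (\<Sum>t\<in>A. h t x))"
    by (intro jet_add) auto
  then show ?case unfolding sum.insert[OF insert.hyps] .
qed

lemma vertex_boundary: "v i \<in> boundary"
proof -
  obtain k where "k \<noteq> i" using ex_index_outside_pair by blast
  then show ?thesis using vertex_face[of i k] by (auto simp: boundary_def)
qed

lemma normal_trace_jet:
  assumes "jet z a h"
  shows "normal_trace v i z = on_set (face v i) (\<lambda>x. h x \<bullet> outer_normal v i)"
  unfolding normal_trace_def boundary_value_def
proof (rule on_set_cong, rule tendsto_Lim)
  fix x assume "x \<in> face v i"
  then have x: "x \<in> boundary" by (auto simp: boundary_def)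
  then show "at x within I \<noteq> bot" using at_I_nontrivial boundary_T by blast
  show "((\<lambda>y. grad z y \<bullet> outer_normal v i) \<longlongrightarrow> h x \<bullet> outer_normal v i) (at x within I)"
    using assms x by (auto intro!: tendsto_intros simp: jet_def)
qed

lemma hermite_dofs_jet:
  assumes "jet z a h"
  shows "hermite_dofs v z = (\<chi> i. (a i, h (v i)))"
proof -
  have nt: "at (v i) within I \<noteq> bot" for i using at_I_nontrivial boundary_T vertex_boundary by blast
  have "Lim (at (v i) within I) z = a i" "Lim (at (v i) within I) (grad z) = h (v i)" for i
    by (rule tendsto_Lim[OF nt]; use assms vertex_boundary in \<open>auto simp: jet_def\<close>)+
  then show ?thesis
    by (simp add: hermite_dofs_def boundary_value_def)
qed

end

section \<open>The functions \<open>\<Phi>\<close> and their boundary behaviour\<close>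

text \<open>With this symmetry only two shapes of generators remain, provided that the order of \<open>l\<close> and \<open>m\<close> is
forgotten.\<close>

lemma Phi_m_swap: "Phi_m l m n = Phi_l m l n"
  by (simp add: fun_eq_iff Phi_m_def Phi_l_def mult_ac)

lemma Phi_forms_induct [consumes 1, case_names zero step_l step_n]:
  assumes "F \<in> Phi_forms i" "P 0"
    and "\<And>c l m n F. {i, l, m, n} = UNIV \<Longrightarrow> P F \<Longrightarrow> P (c *\<^sub>R Phi_l l m n + F)"
    and "\<And>c l m n F. {i, l, m, n} = UNIV \<Longrightarrow> P F \<Longrightarrow> P (c *\<^sub>R Phi_n l m n + F)"
  shows "P F"
  using assms(1) unfolding Phi_forms_def
proof (induction rule: span_induct_alt)
  case base
  then show ?case by fact
next
  case (step c x y)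
  then obtain l m n where lmn: "{i, l, m, n} = UNIV"
    and x: "x = Phi_l l m n \<or> x = Phi_m l m n \<or> x = Phi_n l m n" by blast
  have "{i, m, l, n} = UNIV" using lmn by auto
  then show ?case using x lmn step(2) assms(3,4) unfolding Phi_m_swap by blast
qed

context tetra
begin

text \<open>The gradient of \<open>f\<close> may blow up at the boundary, but no faster than \<open>1 / w\<close>.  For a fixed weight the
class is an algebra; for \<open>w = 1\<close> it consists of the bounded functions with bounded gradient.\<close>

definition weighted where
  "weighted w f \<longleftrightarrow> (\<exists>G B. \<forall>x\<in>I. GDERIV f x :> G x \<and> \<bar>f x\<bar> \<le> B \<and> norm (w x *\<^sub>R G x) \<le> (B::real))"

lemma weightedE:
  assumes "weighted w f"
  obtains G B where "\<And>x. x \<in> I \<Longrightarrow> GDERIV f x :> G x" "\<And>x. x \<in> I \<Longrightarrow> \<bar>f x\<bar> \<le> B"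
    "\<And>x. x \<in> I \<Longrightarrow> norm (w x *\<^sub>R G x) \<le> B"
proof -
  from assms obtain G B where "\<forall>x\<in>I. GDERIV f x :> G x \<and> \<bar>f x\<bar> \<le> B \<and> norm (w x *\<^sub>R G x) \<le> B"
    unfolding weighted_def by blast
  then show thesis by (intro that[of G B]) blast+
qed

lemma weighted_const: "weighted w (\<lambda>x. c)"
  unfolding weighted_def
  by (intro exI[of _ "\<lambda>x. 0"] exI[of _ "\<bar>c\<bar>"]) (auto intro: GDERIV_const)

lemma weighted_bary:
  assumes "\<And>x. x \<in> I \<Longrightarrow> \<bar>w x\<bar> \<le> 1"
  shows "weighted w (\<lambda>x. L x j)"
  unfolding weighted_def
proof (intro exI[of _ "\<lambda>x. g j"] exI[of _ "1 + norm (g j)"] ballI conjI GDERIV_bary)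
  fix x assume x: "x \<in> I"
  then show "\<bar>L x j\<bar> \<le> 1 + norm (g j)"
    using bary_le_1[OF I_subset_T[OF x], of j] by (simp add: I_iff less_imp_le add_increasing2)
  have "\<bar>w x\<bar> * norm (g j) \<le> 1 * norm (g j)"
    by (rule mult_right_mono) (use assms x in auto)
  then show "norm (w x *\<^sub>R g j) \<le> 1 + norm (g j)" by simp
qed

lemma weighted_add:
  assumes "weighted w f" "weighted w h"
  shows "weighted w (\<lambda>x. f x + h x)"
proof -
  obtain G B where f: "\<And>x. x \<in> I \<Longrightarrow> GDERIV f x :> G x" "\<And>x. x \<in> I \<Longrightarrow> \<bar>f x\<bar> \<le> B" "\<And>x. x \<in> I \<Longrightarrow> norm (w x *\<^sub>R G x) \<le> B"
    by (rule weightedE[OF assms(1)], blast)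
  obtain H C where h: "\<And>x. x \<in> I \<Longrightarrow> GDERIV h x :> H x" "\<And>x. x \<in> I \<Longrightarrow> \<bar>h x\<bar> \<le> C" "\<And>x. x \<in> I \<Longrightarrow> norm (w x *\<^sub>R H x) \<le> C"
    by (rule weightedE[OF assms(2)], blast)
  show ?thesis
    unfolding weighted_def
  proof (intro exI[of _ "\<lambda>x. G x + H x"] exI[of _ "B + C"] ballI conjI)
    fix x assume x: "x \<in> I"
    show "GDERIV (\<lambda>x. f x + h x) x :> G x + H x" using f(1) h(1) x by (intro GDERIV_add)
    show "\<bar>f x + h x\<bar> \<le> B + C" using f(2)[OF x] h(2)[OF x] by linarith
    show "norm (w x *\<^sub>R (G x + H x)) \<le> B + C"
      using f(3)[OF x] h(3)[OF x] norm_triangle_ineq[of "w x *\<^sub>R G x" "w x *\<^sub>R H x"]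
      by (simp only: scaleR_add_right)
  qed
qed

lemma weighted_mult:
  assumes "weighted w f" "weighted w h"
  shows "weighted w (\<lambda>x. f x * h x)"
proof -
  obtain G B where f: "\<And>x. x \<in> I \<Longrightarrow> GDERIV f x :> G x" "\<And>x. x \<in> I \<Longrightarrow> \<bar>f x\<bar> \<le> B" "\<And>x. x \<in> I \<Longrightarrow> norm (w x *\<^sub>R G x) \<le> B"
    by (rule weightedE[OF assms(1)], blast)
  obtain H C where h: "\<And>x. x \<in> I \<Longrightarrow> GDERIV h x :> H x" "\<And>x. x \<in> I \<Longrightarrow> \<bar>h x\<bar> \<le> C" "\<And>x. x \<in> I \<Longrightarrow> norm (w x *\<^sub>R H x) \<le> C"
    by (rule weightedE[OF assms(2)], blast)
  show ?thesis
    unfolding weighted_def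
  proof (intro exI[of _ "\<lambda>x. f x *\<^sub>R H x + h x *\<^sub>R G x"] exI[of _ "B * C + C * B"] ballI conjI)
    fix x assume x: "x \<in> I"
    show "GDERIV (\<lambda>x. f x * h x) x :> f x *\<^sub>R H x + h x *\<^sub>R G x"
      using f(1) h(1) x by (intro GDERIV_mult)
    have pos: "0 \<le> B" "0 \<le> C" using f(2)[OF x] h(2)[OF x] by linarith+
    have "\<bar>f x * h x\<bar> \<le> B * C"
      unfolding abs_mult using f(2)[OF x] h(2)[OF x] pos by (intro mult_mono) auto
    then show "\<bar>f x * h x\<bar> \<le> B * C + C * B" using pos by (simp add: add_increasing2)
    have "norm (f x *\<^sub>R (w x *\<^sub>R H x)) \<le> B * C"
      unfolding norm_scaleR[of "f x"] using f(2)[OF x] h(3)[OF x] pos by (intro mult_mono) auto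
    moreover have "norm (h x *\<^sub>R (w x *\<^sub>R G x)) \<le> C * B"
      unfolding norm_scaleR[of "h x"] using h(2)[OF x] f(3)[OF x] pos by (intro mult_mono) auto
    moreover have "w x *\<^sub>R (f x *\<^sub>R H x + h x *\<^sub>R G x) = f x *\<^sub>R (w x *\<^sub>R H x) + h x *\<^sub>R (w x *\<^sub>R G x)"
      by (simp add: scaleR_add_right mult_ac)
    ultimately show "norm (w x *\<^sub>R (f x *\<^sub>R H x + h x *\<^sub>R G x)) \<le> B * C + C * B"
      using norm_triangle_mono by metis
  qed
qed

lemma weighted_cong:
  assumes "weighted w f" "\<And>x. x \<in> I \<Longrightarrow> f x = h x"
  shows "weighted w h"
proof -
  have "GDERIV h x :> D" if "GDERIV f x :> D" "x \<in> I" for x D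
    using that unfolding gderiv_def
    by (rule has_derivative_transform_within_open[OF _ open_interior]) (auto simp: assms)
  moreover obtain G B where "\<And>x. x \<in> I \<Longrightarrow> GDERIV f x :> G x" "\<And>x. x \<in> I \<Longrightarrow> \<bar>f x\<bar> \<le> B"
    "\<And>x. x \<in> I \<Longrightarrow> norm (w x *\<^sub>R G x) \<le> B"
    by (rule weightedE[OF assms(1)], blast)
  ultimately show ?thesis unfolding weighted_def
    by (intro exI[of _ G] exI[of _ B]) (simp add: assms(2)[symmetric] del: gderiv_deriv)
qed

text \<open>Multiplying by the weight tames the gradient: \<open>\<nabla>(w f) = w \<nabla>f + f \<nabla>w\<close>, and both terms are bounded.\<close>

lemma weighted_absorb:
  assumes "weighted w f" "weighted (\<lambda>x. 1) w"
  shows "weighted (\<lambda>x. 1) (\<lambda>x. w x * f x)"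
proof -
  obtain G B where f: "\<And>x. x \<in> I \<Longrightarrow> GDERIV f x :> G x" "\<And>x. x \<in> I \<Longrightarrow> \<bar>f x\<bar> \<le> B" "\<And>x. x \<in> I \<Longrightarrow> norm (w x *\<^sub>R G x) \<le> B"
    by (rule weightedE[OF assms(1)], blast)
  obtain H C where w: "\<And>x. x \<in> I \<Longrightarrow> GDERIV w x :> H x" "\<And>x. x \<in> I \<Longrightarrow> \<bar>w x\<bar> \<le> C" "\<And>x. x \<in> I \<Longrightarrow> norm (1 *\<^sub>R H x) \<le> C"
    by (rule weightedE[OF assms(2)], blast)
  show ?thesis
    unfolding weighted_def
  proof (intro exI[of _ "\<lambda>x. w x *\<^sub>R G x + f x *\<^sub>R H x"] exI[of _ "B + B * C"] ballI conjI)
    fix x assume x: "x \<in> I"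
    show "GDERIV (\<lambda>x. w x * f x) x :> w x *\<^sub>R G x + f x *\<^sub>R H x"
      using f(1) w(1) x by (intro GDERIV_mult)
    have pos: "0 \<le> B" "0 \<le> C" using f(2)[OF x] w(2)[OF x] by linarith+
    have "\<bar>w x * f x\<bar> \<le> C * B"
      unfolding abs_mult using f(2)[OF x] w(2)[OF x] pos by (intro mult_mono) auto
    then show "\<bar>w x * f x\<bar> \<le> B + B * C" using pos by (simp add: mult.commute)
    have "norm (f x *\<^sub>R H x) \<le> B * C"
      unfolding norm_scaleR using f(2)[OF x] w(3)[OF x] pos by (intro mult_mono) auto
    then show "norm (1 *\<^sub>R (w x *\<^sub>R G x + f x *\<^sub>R H x)) \<le> B + B * C"
      using f(3)[OF x] norm_triangle_ineq[of "w x *\<^sub>R G x" "f x *\<^sub>R H x"] by simp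
  qed
qed

lemma GDERIV_ratio:
  assumes "x \<in> I"
  shows "GDERIV (\<lambda>x. L x l / (L x n + L x l)) x :>
    (L x n / (L x n + L x l)\<^sup>2) *\<^sub>R g l - (L x l / (L x n + L x l)\<^sup>2) *\<^sub>R g n"
proof -
  have "L x n > 0" "L x l > 0" using assms by (auto simp: I_iff)
  then have "L x n + L x l \<noteq> 0" by linarith
  then show ?thesis
    unfolding gderiv_def
    by (auto intro!: derivative_eq_intros GDERIV_bary[unfolded gderiv_def]
        simp: inner_diff_right fun_eq_iff field_simps power2_eq_square)
      (simp add: diff_divide_distrib)
qed

lemma ratio_unit: "x \<in> I \<Longrightarrow> 0 \<le> L x l / (L x n + L x l) \<and> L x l / (L x n + L x l) \<le> 1"
  by (simp add: I_iff less_imp_le add_pos_pos divide_le_eq_1)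

text \<open>The gradient has entries \<open>\<lambda>\<^sub>n / (\<lambda>\<^sub>n + \<lambda>\<^sub>l)\<^sup>2\<close> and \<open>\<lambda>\<^sub>l / (\<lambda>\<^sub>n + \<lambda>\<^sub>l)\<^sup>2\<close>, so one factor \<open>\<lambda>\<^sub>n\<close> or \<open>\<lambda>\<^sub>l\<close>
makes it bounded.  Both weights are needed: \<open>Phi_n\<close> contains squares of ratios next to either factor.\<close>

lemma weighted_ratio:
  assumes k: "k = n \<or> k = l"
  shows "weighted (\<lambda>x. L x k) (\<lambda>x. L x l / (L x n + L x l))"
  unfolding weighted_def
proof (intro exI ballI conjI)
  fix x assume x: "x \<in> I"
  show "GDERIV (\<lambda>x. L x l / (L x n + L x l)) x :>
    (L x n / (L x n + L x l)\<^sup>2) *\<^sub>R g l - (L x l / (L x n + L x l)\<^sup>2) *\<^sub>R g n"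
    by (rule GDERIV_ratio[OF x])
  have "\<bar>L x l / (L x n + L x l)\<bar> \<le> 1"
    using ratio_unit[OF x, of l n] by (simp only: abs_of_nonneg)
  then show "\<bar>L x l / (L x n + L x l)\<bar> \<le> 1 + norm (g l) + norm (g n)"
    using norm_ge_zero[of "g l"] norm_ge_zero[of "g n"] by linarith
  have pos: "L x n > 0" "L x l > 0" using x by (auto simp: I_iff)
  have 1: "\<bar>L x k * (L x n / (L x n + L x l)\<^sup>2)\<bar> \<le> 1" "\<bar>L x k * (L x l / (L x n + L x l)\<^sup>2)\<bar> \<le> 1"
    using k pos by (auto simp: abs_mult power2_eq_square divide_le_eq_1 algebra_simps add_pos_pos)
  have "norm (L x k *\<^sub>R (L x n / (L x n + L x l)\<^sup>2) *\<^sub>R g l) \<le> norm (g l)"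
    using mult_right_mono[OF 1(1), of "norm (g l)"] by (simp only: scaleR_scaleR norm_scaleR) simp
  moreover have "norm (L x k *\<^sub>R (L x l / (L x n + L x l)\<^sup>2) *\<^sub>R g n) \<le> norm (g n)"
    using mult_right_mono[OF 1(2), of "norm (g n)"] by (simp only: scaleR_scaleR norm_scaleR) simp
  ultimately show "norm (L x k *\<^sub>R ((L x n / (L x n + L x l)\<^sup>2) *\<^sub>R g l - (L x l / (L x n + L x l)\<^sup>2) *\<^sub>R g n))
      \<le> 1 + norm (g l) + norm (g n)"
    using norm_triangle_ineq4[of "L x k *\<^sub>R (L x n / (L x n + L x l)\<^sup>2) *\<^sub>R g l" "L x k *\<^sub>R (L x l / (L x n + L x l)\<^sup>2) *\<^sub>R g n"]
    by (simp only: scaleR_diff_right)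
qed

lemma weight_bary_le_1: "x \<in> I \<Longrightarrow> \<bar>L x k\<bar> \<le> 1"
  using bary_le_1[OF I_subset_T, of x k] by (simp add: I_iff less_imp_le)

lemma weighted_bary_1: "weighted (\<lambda>x. 1) (\<lambda>x. L x j)"
  by (rule weighted_bary) simp

lemmas weighted_intros = weighted_const weighted_bary[OF weight_bary_le_1] weighted_bary_1
  weighted_add weighted_mult

definition ratio where "ratio l n x = L x l / (L x n + L x l)"

text \<open>Written with ratios, every unbounded gradient is accompanied by a coordinate that compensates it.\<close>

lemma Phi_l_ratio:
  assumes "x \<in> I"
  shows "Phi_l l m n (L x) = L x n * (L x m * (ratio l n x * (2 - ratio l n x) * ratio m n x))"
proof -
  have "L x n > 0" "L x l > 0" "L x m > 0" using assms by (auto simp: I_iff)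
  then have "L x n + L x l \<noteq> 0" "L x n + L x m \<noteq> 0" by linarith+
  then show ?thesis by (simp add: Phi_l_def ratio_def field_simps power2_eq_square)
qed

text \<open>Each of the first two groups \<open>\<lambda>\<^sub>l r\<^sup>2\<close>, \<open>\<lambda>\<^sub>m s\<^sup>2\<close> has a bounded gradient by itself, and in the third
the factor \<open>\<lambda>\<^sub>n\<close> compensates both ratios at once.\<close>

lemma Phi_n_ratio:
  assumes "x \<in> I"
  shows "Phi_n l m n (L x) = (L x l * (ratio l n x)\<^sup>2) * (L x m * (ratio m n x)\<^sup>2)
     - L x n * (L x n * ((ratio l n x)\<^sup>2 * (ratio m n x)\<^sup>2)) - L x l * L x m"
proof -
  have "Phi_n l m n (L x) = (ratio l n x)\<^sup>2 * (ratio m n x)\<^sup>2 * (L x l * L x m - (L x n)\<^sup>2) - L x l * L x m"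
    by (simp add: Phi_n_def ratio_def power_divide)
  then show ?thesis by (simp add: algebra_simps power2_eq_square)
qed

lemma weighted_ratio': "weighted (\<lambda>x. L x n) (ratio l n)" "weighted (\<lambda>x. L x l) (ratio l n)"
  using weighted_ratio[of n n l] weighted_ratio[of l n l] by (simp_all add: ratio_def[abs_def])

lemma weighted_power2: "weighted w f \<Longrightarrow> weighted w (\<lambda>x. (f x)\<^sup>2)"
  unfolding power2_eq_square by (rule weighted_mult)

lemma weighted_diff: "weighted w f \<Longrightarrow> weighted w h \<Longrightarrow> weighted w (\<lambda>x. f x - h x)"
  using weighted_add[of w f "\<lambda>x. (-1) * h x"] weighted_mult[OF weighted_const, of w h "-1"] by simp

lemma weighted_Phi_l: "weighted (\<lambda>x. 1) (\<lambda>x. Phi_l l m n (L x))"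
proof (rule weighted_cong[OF _ Phi_l_ratio[symmetric]])
  show "weighted (\<lambda>x. 1) (\<lambda>x. L x n * (L x m * (ratio l n x * (2 - ratio l n x) * ratio m n x)))"
    by (rule weighted_absorb; intro weighted_intros weighted_diff weighted_ratio')
qed

lemma weighted_Phi_n: "weighted (\<lambda>x. 1) (\<lambda>x. Phi_n l m n (L x))"
proof (rule weighted_cong[OF _ Phi_n_ratio[symmetric]])
  have a: "weighted (\<lambda>x. 1) (\<lambda>x. L x l * (ratio l n x)\<^sup>2)" "weighted (\<lambda>x. 1) (\<lambda>x. L x m * (ratio m n x)\<^sup>2)"
    "weighted (\<lambda>x. 1) (\<lambda>x. L x n * (L x n * ((ratio l n x)\<^sup>2 * (ratio m n x)\<^sup>2)))"
    by (rule weighted_absorb; intro weighted_intros weighted_power2 weighted_ratio')+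
  show "weighted (\<lambda>x. 1) (\<lambda>x. (L x l * (ratio l n x)\<^sup>2) * (L x m * (ratio m n x)\<^sup>2)
     - L x n * (L x n * ((ratio l n x)\<^sup>2 * (ratio m n x)\<^sup>2)) - L x l * L x m)"
    by (rule weighted_diff[OF weighted_diff[OF weighted_mult[OF a(1,2)] a(3)]
          weighted_mult[OF weighted_bary_1 weighted_bary_1]])
qed

lemma weighted_form:
  assumes "F \<in> Phi_forms i"
  shows "weighted (\<lambda>x. 1) (\<lambda>x. F (L x))"
  using assms
proof (induction rule: Phi_forms_induct)
  case zero
  show ?case unfolding zero_fun_def by (rule weighted_const)
next
  case (step_l c l m n F)
  then show ?case unfolding plus_fun_def scaleR_fun_def real_scaleR_def
    by (intro weighted_intros weighted_Phi_l)
next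
  case (step_n c l m n F)
  then show ?case unfolding plus_fun_def scaleR_fun_def real_scaleR_def
    by (intro weighted_intros weighted_Phi_n)
qed

lemma tendsto_squeeze_I:
  fixes f :: "real^3 \<Rightarrow> real"
  assumes "\<And>y. y \<in> I \<Longrightarrow> \<bar>f y\<bar> \<le> b y" "(b \<longlongrightarrow> 0) (at x within I)"
  shows "(f \<longlongrightarrow> 0) (at x within I)"
  by (rule Lim_null_comparison[OF _ assms(2)]) (simp add: eventually_at_filter assms(1))

lemma bary_nonneg: "x \<in> T \<Longrightarrow> 0 \<le> L x j"
  by (simp add: T_iff)

lemma ratio_le1: "x \<in> I \<Longrightarrow> 0 \<le> ratio l n x" "x \<in> I \<Longrightarrow> ratio l n x \<le> 1"
  using ratio_unit[of x l n] by (simp_all add: ratio_def)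

text \<open>Where a denominator vanishes, \<open>\<lambda>\<^sub>n\<close> vanishes, and \<open>|Phi_l| \<le> 2 \<lambda>\<^sub>n\<close>.  Elsewhere the formula is continuous.\<close>

lemma Phi_l_tendsto:
  assumes x: "x \<in> T"
  shows "((\<lambda>y. Phi_l l m n (L y)) \<longlongrightarrow> Phi_l l m n (L x)) (at x within I)"
proof (cases "L x n + L x l = 0 \<or> L x n + L x m = 0")
  case True
  then have n0: "L x n = 0" using bary_nonneg[OF x] by (metis add_nonneg_eq_0_iff)
  have "((\<lambda>y. Phi_l l m n (L y)) \<longlongrightarrow> 0) (at x within I)"
  proof (rule tendsto_squeeze_I[where b = "\<lambda>y. L y n * 2"])
    fix y assume y: "y \<in> I"
    let ?r = "ratio l n y" and ?s = "ratio m n y"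
    have b: "0 \<le> ?r" "?r \<le> 1" "0 \<le> ?s" "?s \<le> 1" "0 \<le> L y m" "L y m \<le> 1" "0 \<le> L y n"
      using ratio_le1 bary_le_1 I_subset_T bary_nonneg y by blast+
    have "?r * (2 - ?r) * ?s \<le> (1 * 2) * 1" using b by (intro mult_mono) auto
    then have "L y m * (?r * (2 - ?r) * ?s) \<le> 1 * 2" using b by (intro mult_mono) auto
    then have "L y n * (L y m * (?r * (2 - ?r) * ?s)) \<le> L y n * 2" using b by (intro mult_left_mono) auto
    then show "\<bar>Phi_l l m n (L y)\<bar> \<le> L y n * 2" using b by (simp add: Phi_l_ratio[OF y])
  next
    have "((\<lambda>y. L y n * 2) \<longlongrightarrow> L x n * 2) (at x within I)" by (intro tendsto_intros)
    then show "((\<lambda>y. L y n * 2) \<longlongrightarrow> 0) (at x within I)" by (simp add: n0)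
  qed
  then show ?thesis by (simp add: Phi_l_def[of l m n "L x"] n0)
next
  case False
  then show ?thesis unfolding Phi_l_def by (intro tendsto_intros) auto
qed

text \<open>Where a denominator vanishes, so do \<open>\<lambda>\<^sub>n\<close> and \<open>\<lambda>\<^sub>l\<lambda>\<^sub>m\<close>, and \<open>|Phi_n| \<le> 2 \<lambda>\<^sub>l\<lambda>\<^sub>m + \<lambda>\<^sub>n\<^sup>2\<close>.\<close>

lemma Phi_n_tendsto:
  assumes x: "x \<in> T"
  shows "((\<lambda>y. Phi_n l m n (L y)) \<longlongrightarrow> Phi_n l m n (L x)) (at x within I)"
proof (cases "L x n + L x l = 0 \<or> L x n + L x m = 0")
  case True
  then have n0: "L x n = 0" "L x l * L x m = 0"
    using bary_nonneg[OF x] by (metis add_nonneg_eq_0_iff mult_zero_left mult_zero_right)+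
  have "((\<lambda>y. Phi_n l m n (L y)) \<longlongrightarrow> 0) (at x within I)"
  proof (rule tendsto_squeeze_I[where b = "\<lambda>y. 2 * (L y l * L y m) + L y n * L y n"])
    fix y assume y: "y \<in> I"
    let ?r = "ratio l n y" and ?s = "ratio m n y"
    have b: "0 \<le> ?r" "?r \<le> 1" "0 \<le> ?s" "?s \<le> 1" "0 \<le> L y m" "0 \<le> L y l" "0 \<le> L y n"
      using ratio_le1 I_subset_T bary_nonneg y by blast+
    have rs: "?r\<^sup>2 \<le> 1" "?s\<^sup>2 \<le> 1" "?r\<^sup>2 * ?s\<^sup>2 \<le> 1" using b by (simp_all add: power_le_one mult_le_one)
    have "(L y l * ?r\<^sup>2) * (L y m * ?s\<^sup>2) \<le> (L y l * 1) * (L y m * 1)"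
      using b rs by (intro mult_mono) auto
    moreover have "0 \<le> (L y l * ?r\<^sup>2) * (L y m * ?s\<^sup>2)" "0 \<le> L y n * (L y n * (?r\<^sup>2 * ?s\<^sup>2))" "0 \<le> L y l * L y m"
      using b by simp_all
    moreover have "L y n * (L y n * (?r\<^sup>2 * ?s\<^sup>2)) \<le> L y n * (L y n * 1)"
      using b rs by (intro mult_left_mono) auto
    ultimately show "\<bar>Phi_n l m n (L y)\<bar> \<le> 2 * (L y l * L y m) + L y n * L y n"
      unfolding Phi_n_ratio[OF y] abs_le_iff mult_1_right by linarith
  next
    have "((\<lambda>y. 2 * (L y l * L y m) + L y n * L y n) \<longlongrightarrow> 2 * (L x l * L x m) + L x n * L x n) (at x within I)"
      by (intro tendsto_intros)
    then show "((\<lambda>y. 2 * (L y l * L y m) + L y n * L y n) \<longlongrightarrow> 0) (at x within I)" by (simp only: n0) simp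
  qed
  moreover have "Phi_n l m n (L x) = 0"
    using n0 by (auto simp: Phi_n_def)
  ultimately show ?thesis by simp
next
  case False
  then show ?thesis unfolding Phi_n_def by (intro tendsto_intros) auto
qed

lemma form_tendsto:
  assumes "F \<in> Phi_forms i" and x: "x \<in> T"
  shows "((\<lambda>y. F (L y)) \<longlongrightarrow> F (L x)) (at x within I)"
  using assms(1)
proof (induction rule: Phi_forms_induct)
  case zero
  show ?case unfolding zero_fun_def by (rule tendsto_const)
next
  case (step_l c l m n F)
  then show ?case unfolding plus_fun_def scaleR_fun_def real_scaleR_def
    by (intro tendsto_intros Phi_l_tendsto[OF x])
next
  case (step_n c l m n F)
  then show ?case unfolding plus_fun_def scaleR_fun_def real_scaleR_def
    by (intro tendsto_intros Phi_n_tendsto[OF x])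
qed

end

lemma form_vanishes:
  assumes "F \<in> Phi_forms i" and "\<mu> j = 0" "j \<noteq> i"
  shows "F \<mu> = 0"
  using assms(1)
proof (induction rule: Phi_forms_induct)
  case zero
  show ?case by simp
next
  case (step_l c l m n F)
  then have "j \<in> {l, m, n}" using assms(3) by (metis UNIV_I insert_iff)
  then have "Phi_l l m n \<mu> = 0" using assms(2) by (auto simp: Phi_l_def)
  then show ?case using step_l by (simp add: scaleR_fun_def)
next
  case (step_n c l m n F)
  then have "j \<in> {l, m, n}" using assms(3) by (metis UNIV_I insert_iff)
  then have "Phi_n l m n \<mu> = 0"
    using assms(2) by (auto simp: Phi_n_def power2_eq_square)
  then show ?case using step_n by (simp add: scaleR_fun_def)
qed

text \<open>Homogeneity of degree two, together with independence of the coordinate \<open>i\<close>: a form is determined by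
its values on the face.\<close>

lemma form_homogeneous:
  assumes "F \<in> Phi_forms i" and "s \<noteq> 0"
  shows "s\<^sup>2 * F (\<lambda>j. if j = i then 0 else \<mu> j / s) = F \<mu>"
  using assms(1)
proof (induction rule: Phi_forms_induct)
  case zero
  show ?case by simp
next
  case (step_l c l m n F)
  have ne: "l \<noteq> i" "m \<noteq> i" "n \<noteq> i" using four_indices_distinct[OF step_l(1)] by auto
  have "s\<^sup>2 * Phi_l l m n (\<lambda>j. if j = i then 0 else \<mu> j / s) = Phi_l l m n \<mu>"
    using assms(2) by (simp add: Phi_l_def ne divide_simps flip: add_divide_distrib)
      (simp add: algebra_simps power2_eq_square)
  then show ?case using step_l(2) by (simp add: scaleR_fun_def algebra_simps)
next
  case (step_n c l m n F)
  have ne: "l \<noteq> i" "m \<noteq> i" "n \<noteq> i" using four_indices_distinct[OF step_n(1)] by auto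
  have "s\<^sup>2 * Phi_n l m n (\<lambda>j. if j = i then 0 else \<mu> j / s) = Phi_n l m n \<mu>"
    using assms(2) by (simp add: Phi_n_def ne divide_simps flip: add_divide_distrib)
      (simp add: algebra_simps power2_eq_square)
  then show ?case using step_n(2) by (simp add: scaleR_fun_def algebra_simps)
qed

section \<open>Boundary limits of edge bubbles and normal lifts\<close>

text \<open>One index for each bubble \<open>E\<^sub>l\<^sub>m\<^sup>n\<close>; the first component \<open>i\<close> is the face on which the normal derivative
of the bubble is not a polynomial.\<close>

definition bubble_indices :: "(4 \<times> 4 \<times> 4 \<times> 4) set" where
  "bubble_indices = {(i, l, m, n). l < m \<and> {i, l, m, n} = UNIV}"

context tetra
begin

lemma edge_bubble_eq:
  "edge_bubble v l m n = on_set I (\<lambda>x. L x n * (L x l * ratio l n x) * (L x m * ratio m n x))"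
  by (simp add: edge_bubble_def ratio_def power2_eq_square mult_ac)

text \<open>The left side is what the product rule gives for \<open>n (l r) (m s)\<close> with the ratios \<open>r = l / (n + l)\<close>,
\<open>s = m / (n + m)\<close>; the letters \<open>a\<close>, \<open>b\<close>, \<open>c\<close> stand for the components of the gradients of
\<open>l\<close>, \<open>m\<close>, \<open>n\<close>.\<close>

lemma edge_bubble_grad_coeff:
  fixes n l m a b c :: real
  assumes "n > 0" "l > 0" "m > 0"
  shows "n * (l * (l / (n + l))) * (m * (n / (n + m)\<^sup>2 * b - m / (n + m)\<^sup>2 * c) + m / (n + m) * b)
     + m * (m / (n + m)) * (n * (l * (n / (n + l)\<^sup>2 * a - l / (n + l)\<^sup>2 * c) + l / (n + l) * a)
         + l * (l / (n + l)) * c)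
   = n * l * m\<^sup>2 * (2 * n + l) / ((n + l)\<^sup>2 * (n + m)) * a
     + n * l\<^sup>2 * m * (2 * n + m) / ((n + l) * (n + m)\<^sup>2) * b
     + l\<^sup>2 * m\<^sup>2 * (l * m - n\<^sup>2) / ((n + l)\<^sup>2 * (n + m)\<^sup>2) * c"
proof -
  \<comment> \<open>With the denominators as variables, clearing them leaves a polynomial identity.\<close>
  define p q where "p = n + l" and "q = n + m"
  have pq: "p \<noteq> 0" "q \<noteq> 0" and lm: "l = p - n" "m = q - n" using assms by (auto simp: p_def q_def)
  show ?thesis
    unfolding p_def[symmetric] q_def[symmetric]
    using pq by (simp add: field_simps power2_eq_square) (simp add: lm algebra_simps)
qed

lemma GDERIV_edge_bubble:
  assumes x: "x \<in> I"
  shows "GDERIV (\<lambda>x. L x n * (L x l * ratio l n x) * (L x m * ratio m n x)) x :>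
    Phi_l l m n (L x) *\<^sub>R g l + Phi_m l m n (L x) *\<^sub>R g m + (Phi_n l m n (L x) + L x l * L x m) *\<^sub>R g n"
proof (rule GDERIV_subst)
  note r = GDERIV_ratio[OF x, folded ratio_def]
  show "GDERIV (\<lambda>x. L x n * (L x l * ratio l n x) * (L x m * ratio m n x)) x :>
     (L x n * (L x l * ratio l n x)) *\<^sub>R (L x m *\<^sub>R ((L x n / (L x n + L x m)\<^sup>2) *\<^sub>R g m - (L x m / (L x n + L x m)\<^sup>2) *\<^sub>R g n) + ratio m n x *\<^sub>R g m)
     + (L x m * ratio m n x) *\<^sub>R (L x n *\<^sub>R (L x l *\<^sub>R ((L x n / (L x n + L x l)\<^sup>2) *\<^sub>R g l - (L x l / (L x n + L x l)\<^sup>2) *\<^sub>R g n) + ratio l n x *\<^sub>R g l)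
        + (L x l * ratio l n x) *\<^sub>R g n)"
    by (intro GDERIV_mult GDERIV_bary r)
  have pos: "L x n > 0" "L x l > 0" "L x m > 0" using x by (auto simp: I_iff)
  show "(L x n * (L x l * ratio l n x)) *\<^sub>R (L x m *\<^sub>R ((L x n / (L x n + L x m)\<^sup>2) *\<^sub>R g m - (L x m / (L x n + L x m)\<^sup>2) *\<^sub>R g n) + ratio m n x *\<^sub>R g m)
     + (L x m * ratio m n x) *\<^sub>R (L x n *\<^sub>R (L x l *\<^sub>R ((L x n / (L x n + L x l)\<^sup>2) *\<^sub>R g l - (L x l / (L x n + L x l)\<^sup>2) *\<^sub>R g n) + ratio l n x *\<^sub>R g l)
        + (L x l * ratio l n x) *\<^sub>R g n)
    = Phi_l l m n (L x) *\<^sub>R g l + Phi_m l m n (L x) *\<^sub>R g m + (Phi_n l m n (L x) + L x l * L x m) *\<^sub>R g n"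
    (is "?A = ?B")
  proof (rule vector_eq_rdot[THEN iffD1], rule allI)
    fix h
    show "?A \<bullet> h = ?B \<bullet> h"
      using edge_bubble_grad_coeff[OF pos, of "g m \<bullet> h" "g n \<bullet> h" "g l \<bullet> h"]
      by (simp add: inner_add_left inner_diff_left ratio_def Phi_l_def Phi_m_def Phi_n_def)
  qed
qed

text \<open>The partial derivatives of the bubble with respect to \<open>\<lambda>\<^sub>l\<close>, \<open>\<lambda>\<^sub>m\<close>, \<open>\<lambda>\<^sub>n\<close> are \<open>Phi_l\<close>, \<open>Phi_m\<close> and
\<open>Phi_n + \<lambda>\<^sub>l\<lambda>\<^sub>m\<close>; this is where the functions \<open>\<Phi>\<close> come from.  The vertex values vanish because the
bubble is at most \<open>\<lambda>\<^sub>n\<lambda>\<^sub>l\<lambda>\<^sub>m\<close>.\<close>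

lemma edge_bubble_jet:
  assumes idx: "{i, l, m, n} = UNIV"
  shows "jet (edge_bubble v l m n) (\<lambda>_. 0) (\<lambda>x. Phi_l l m n (L x) *\<^sub>R g l + Phi_m l m n (L x) *\<^sub>R g m
      + (Phi_n l m n (L x) + L x l * L x m) *\<^sub>R g n)"
  unfolding edge_bubble_eq
proof (rule jetI)
  fix k
  have "n \<noteq> l" using four_indices_distinct[OF idx] by auto
  have "((\<lambda>y. L y n * L y l * L y m) \<longlongrightarrow> L (v k) n * L (v k) l * L (v k) m) (at (v k) within I)"
    by (intro tendsto_intros)
  then have lim: "((\<lambda>y. L y n * L y l * L y m) \<longlongrightarrow> 0) (at (v k) within I)"
    using \<open>n \<noteq> l\<close> by (cases "n = k") (simp_all add: bary_vertex)
  show "((\<lambda>x. L x n * (L x l * ratio l n x) * (L x m * ratio m n x)) \<longlongrightarrow> 0) (at (v k) within I)"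
  proof (rule tendsto_squeeze_I[OF _ lim])
    fix y assume y: "y \<in> I"
    let ?r = "ratio l n y" and ?s = "ratio m n y"
    have b: "0 \<le> ?r" "?r \<le> 1" "0 \<le> ?s" "?s \<le> 1" "0 \<le> L y m" "0 \<le> L y l" "0 \<le> L y n"
      using ratio_le1 I_subset_T bary_nonneg y by blast+
    then have "L y n * (L y l * ?r) * (L y m * ?s) \<le> L y n * (L y l * 1) * (L y m * 1)"
      by (intro mult_mono mult_nonneg_nonneg) auto
    then show "\<bar>L y n * (L y l * ?r) * (L y m * ?s)\<bar> \<le> L y n * L y l * L y m"
      using b by simp
  qed
next
  fix x assume "x \<in> boundary"
  then have x: "x \<in> T" by (rule boundary_T)
  show "((\<lambda>x. Phi_l l m n (L x) *\<^sub>R g l + Phi_m l m n (L x) *\<^sub>R g m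
      + (Phi_n l m n (L x) + L x l * L x m) *\<^sub>R g n) \<longlongrightarrow> Phi_l l m n (L x) *\<^sub>R g l + Phi_m l m n (L x) *\<^sub>R g m
      + (Phi_n l m n (L x) + L x l * L x m) *\<^sub>R g n) (at x within I)"
    unfolding Phi_m_swap by (intro tendsto_intros Phi_l_tendsto[OF x] Phi_n_tendsto[OF x])
qed (rule GDERIV_edge_bubble)

definition Theta where "Theta i J x = (\<Prod>j\<in>J. L x j / (L x i + L x j))"

lemma ratio_tendsto:
  assumes "L x n + L x l \<noteq> 0"
  shows "(ratio l n \<longlongrightarrow> ratio l n x) (at x within I)"
  unfolding ratio_def[abs_def] using assms by (intro tendsto_intros)

text \<open>Induction over the factors of \<open>\<Theta>\<^sub>i\<close>.  One gradient has to serve two purposes: on the whole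
tetrahedron \<open>\<lambda>\<^sub>i \<nabla>\<Theta>\<^sub>i\<close> is only bounded, while at relative interior points of the face \<open>f\<^sub>i\<close> it tends to
zero and \<open>\<Theta>\<^sub>i\<close> tends to one.\<close>

lemma Theta_gradient:
  fixes J :: "4 set"
  shows "\<exists>G B. (\<forall>y\<in>I. GDERIV (Theta i J) y :> G y \<and> 0 \<le> Theta i J y \<and> Theta i J y \<le> 1 \<and> norm (L y i *\<^sub>R G y) \<le> B)
     \<and> (\<forall>x. L x i = 0 \<and> (\<forall>j\<in>J. L x j > 0) \<longrightarrow>
          (Theta i J \<longlongrightarrow> 1) (at x within I) \<and> ((\<lambda>y. L y i *\<^sub>R G y) \<longlongrightarrow> 0) (at x within I))"
proof (induction J rule: finite_induct[OF finite])
  case 1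
  show ?case
    by (intro exI[of _ "\<lambda>y. 0"] exI[of _ 0]) (auto simp: Theta_def[abs_def] intro: GDERIV_const)
next
  case (2 j J)
  have Th: "Theta i (insert j J) = (\<lambda>y. ratio j i y * Theta i J y)"
    using 2 by (simp add: Theta_def[abs_def] ratio_def)
  define R where "R y = (L y i / (L y i + L y j)\<^sup>2) *\<^sub>R g j - (L y j / (L y i + L y j)\<^sup>2) *\<^sub>R g i" for y
  obtain C where C: "norm (L y i *\<^sub>R R y) \<le> C" if "y \<in> I" for y
  proof -
    obtain R' C where R': "\<And>y. y \<in> I \<Longrightarrow> GDERIV (\<lambda>x. L x j / (L x i + L x j)) y :> R' y" 
      and C: "\<And>y. y \<in> I \<Longrightarrow> norm (L y i *\<^sub>R R' y) \<le> C"
      by (rule weightedE[OF weighted_ratio[of i i j]], blast, blast)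
    have "R' y = R y" if "y \<in> I" for y
      using GDERIV_unique[OF R'[OF that] GDERIV_ratio[OF that]] by (simp add: R_def)
    then show thesis using C that by metis
  qed
  have R: "GDERIV (ratio j i) y :> R y" if "y \<in> I" for y
    using GDERIV_ratio[OF that, of j i] by (simp add: ratio_def[abs_def] R_def)
  from 2(3) obtain G B where
    G: "\<forall>y\<in>I. GDERIV (Theta i J) y :> G y \<and> 0 \<le> Theta i J y \<and> Theta i J y \<le> 1 \<and> norm (L y i *\<^sub>R G y) \<le> B"
    and lim: "\<forall>x. L x i = 0 \<and> (\<forall>j\<in>J. L x j > 0) \<longrightarrow>
          (Theta i J \<longlongrightarrow> 1) (at x within I) \<and> ((\<lambda>y. L y i *\<^sub>R G y) \<longlongrightarrow> 0) (at x within I)"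
    by blast
  let ?G = "\<lambda>y. ratio j i y *\<^sub>R G y + Theta i J y *\<^sub>R R y"
  have wG: "L y i *\<^sub>R ?G y = ratio j i y *\<^sub>R (L y i *\<^sub>R G y) + Theta i J y *\<^sub>R (L y i *\<^sub>R R y)" for y
    by (simp add: scaleR_add_right mult_ac)
  show ?case
  proof (intro exI[of _ ?G] exI[of _ "B + C"] conjI ballI allI impI)
    fix y assume y: "y \<in> I"
    then have b: "0 \<le> Theta i J y" "Theta i J y \<le> 1" "norm (L y i *\<^sub>R G y) \<le> B" "0 \<le> ratio j i y" "ratio j i y \<le> 1"
      using G ratio_le1 by auto
    show "GDERIV (Theta i (insert j J)) y :> ?G y"
      unfolding Th using G y R by (intro GDERIV_mult) auto
    show "0 \<le> Theta i (insert j J) y" "Theta i (insert j J) y \<le> 1"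
      using b by (simp_all add: Th mult_le_one)
    have "norm (ratio j i y *\<^sub>R (L y i *\<^sub>R G y)) \<le> 1 * B"
      unfolding norm_scaleR[of "ratio j i y"] using b by (intro mult_mono) auto
    moreover have "norm (Theta i J y *\<^sub>R (L y i *\<^sub>R R y)) \<le> 1 * C"
      unfolding norm_scaleR[of "Theta i J y"] using b C[OF y] by (intro mult_mono) auto
    ultimately show "norm (L y i *\<^sub>R ?G y) \<le> B + C"
      unfolding wG by (intro norm_triangle_mono) auto
  next
    fix x assume x: "L x i = 0 \<and> (\<forall>j\<in>insert j J. L x j > 0)"
    then have pos: "L x j > 0" "L x i = 0" by auto
    then have r1: "(ratio j i \<longlongrightarrow> 1) (at x within I)"
      using ratio_tendsto[of x i j] by (simp add: ratio_def)
    have th: "(Theta i J \<longlongrightarrow> 1) (at x within I)" "((\<lambda>y. L y i *\<^sub>R G y) \<longlongrightarrow> 0) (at x within I)"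
      using lim x by auto
    show "(Theta i (insert j J) \<longlongrightarrow> 1) (at x within I)"
      unfolding Th using tendsto_mult[OF r1 th(1)] by simp
    have "(R \<longlongrightarrow> R x) (at x within I)"
      unfolding R_def[abs_def] using pos by (intro tendsto_intros) auto
    then have "((\<lambda>y. L y i *\<^sub>R R y) \<longlongrightarrow> L x i *\<^sub>R R x) (at x within I)" by (intro tendsto_intros)
    then have "((\<lambda>y. L y i *\<^sub>R R y) \<longlongrightarrow> 0) (at x within I)" using pos by simp
    then have "((\<lambda>y. ratio j i y *\<^sub>R (L y i *\<^sub>R G y) + Theta i J y *\<^sub>R (L y i *\<^sub>R R y)) \<longlongrightarrow> 1 *\<^sub>R 0 + 1 *\<^sub>R 0) (at x within I)"
      by (intro tendsto_intros r1 th)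
    then show "((\<lambda>y. L y i *\<^sub>R ?G y) \<longlongrightarrow> 0) (at x within I)" unfolding wG by simp
  qed
qed

text \<open>The normal lift of the trace of a formula \<open>F\<close>, expressed by \<open>F\<close> directly.\<close>

definition lift where
  "lift i F = on_set I (\<lambda>x. L x i / dcoef v i i * Theta i (UNIV - {i}) x * F (L x))"

lemma tendsto_bounded_zero:
  fixes f :: "real^3 \<Rightarrow> real" and h :: "real^3 \<Rightarrow> 'b::real_normed_vector"
  assumes "(f \<longlongrightarrow> 0) (at x within I)" "\<And>y. y \<in> I \<Longrightarrow> norm (h y) \<le> B"
  shows "((\<lambda>y. f y *\<^sub>R h y) \<longlongrightarrow> 0) (at x within I)"
proof (rule Lim_null_comparison)
  show "\<forall>\<^sub>F y in at x within I. norm (f y *\<^sub>R h y) \<le> \<bar>f y\<bar> * B"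
    unfolding eventually_at_filter norm_scaleR real_norm_def
    by (intro always_eventually allI impI mult_left_mono assms(2) abs_ge_zero)
  have "((\<lambda>y. \<bar>f y\<bar> * B) \<longlongrightarrow> \<bar>0\<bar> * B) (at x within I)"
    by (intro tendsto_intros assms)
  then show "((\<lambda>y. \<bar>f y\<bar> * B) \<longlongrightarrow> 0) (at x within I)" by simp
qed

lemma Theta_le_ratio:
  assumes "y \<in> I" "k \<in> J"
  shows "Theta i J y \<le> ratio k i y"
proof -
  have "Theta i J y = ratio k i y * (\<Prod>j\<in>J - {k}. ratio j i y)"
    unfolding Theta_def using assms(2) by (simp add: ratio_def prod.remove[of J k])
  also have "\<dots> \<le> ratio k i y * 1"
    using ratio_le1[OF assms(1)] by (intro mult_left_mono prod_le_1) auto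
  finally show ?thesis by simp
qed

text \<open>The gradient of \<open>\<lambda>\<^sub>i \<Theta>\<^sub>i F\<close> has three terms.  In \<open>\<lambda>\<^sub>i \<Theta>\<^sub>i \<nabla>F\<close> the gradient is bounded and
\<open>\<lambda>\<^sub>i \<Theta>\<^sub>i \<rightarrow> 0\<close>, because \<open>\<lambda>\<^sub>i \<Theta>\<^sub>i \<le> \<lambda>\<^sub>k\<close> for every \<open>k\<close>.  The terms \<open>F \<lambda>\<^sub>i \<nabla>\<Theta>\<^sub>i\<close> and \<open>F \<Theta>\<^sub>i g\<^sub>i\<close> are \<open>F\<close>
times something bounded, so they vanish in the limit wherever some \<open>\<lambda>\<^sub>k\<close> with \<open>k \<noteq> i\<close> does.  What is
left is the relative interior of \<open>f\<^sub>i\<close>, where only \<open>F g\<^sub>i\<close> survives.\<close>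

lemma lift_jet:
  assumes F: "F \<in> Phi_forms i"
  shows "jet (lift i F) (\<lambda>_. 0) (\<lambda>x. if L x i = 0 then (F (L x) / dcoef v i i) *\<^sub>R g i else 0)"
proof -
  let ?J = "UNIV - {i}" and ?d = "dcoef v i i" and ?Th = "Theta i (UNIV - {i})"
  obtain G B where
    G: "\<forall>y\<in>I. GDERIV ?Th y :> G y \<and> 0 \<le> ?Th y \<and> ?Th y \<le> 1 \<and> norm (L y i *\<^sub>R G y) \<le> B"
    and lim: "\<forall>x. L x i = 0 \<and> (\<forall>j\<in>?J. L x j > 0) \<longrightarrow>
          (?Th \<longlongrightarrow> 1) (at x within I) \<and> ((\<lambda>y. L y i *\<^sub>R G y) \<longlongrightarrow> 0) (at x within I)"
    using Theta_gradient[of i ?J] by blast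
  obtain H C where H: "\<And>y. y \<in> I \<Longrightarrow> GDERIV (\<lambda>x. F (L x)) y :> H y"
      "\<And>y. y \<in> I \<Longrightarrow> norm (1 *\<^sub>R H y) \<le> C"
    by (rule weightedE[OF weighted_form[OF F]], blast)
  have Th: "GDERIV ?Th y :> G y" "norm (?Th y) \<le> 1" "norm (L y i *\<^sub>R G y) \<le> B" if "y \<in> I" for y
    using G that by auto
  define D where "D y = (1 / ?d) *\<^sub>R ((L y i * ?Th y) *\<^sub>R H y + F (L y) *\<^sub>R (L y i *\<^sub>R G y) + F (L y) *\<^sub>R (?Th y *\<^sub>R g i))" for y
  have der: "GDERIV (\<lambda>x. L x i / ?d * ?Th x * F (L x)) y :> D y" if y: "y \<in> I" for y
  proof -
    have "GDERIV (\<lambda>x. 1 / ?d * (L x i * ?Th x * F (L x))) y :>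
      (1 / ?d) *\<^sub>R ((L y i * ?Th y) *\<^sub>R H y + F (L y) *\<^sub>R (L y i *\<^sub>R G y + ?Th y *\<^sub>R g i)) + (L y i * ?Th y * F (L y)) *\<^sub>R 0"
      by (intro GDERIV_mult GDERIV_bary GDERIV_const Th H y)
    then show ?thesis by (simp add: D_def scaleR_add_right add.assoc mult.assoc)
  qed
  have wTh: "((\<lambda>y. L y i * ?Th y) \<longlongrightarrow> 0) (at x within I)" if x: "x \<in> boundary" for x
  proof -
    obtain k where k: "L x k = 0" using x by (auto simp: boundary_def face_def)
    \<comment> \<open>For \<open>k \<noteq> i\<close> the factor \<open>\<lambda>\<^sub>k / (\<lambda>\<^sub>i + \<lambda>\<^sub>k)\<close> of \<open>\<Theta>\<^sub>i\<close> absorbs \<open>\<lambda>\<^sub>i\<close>.\<close>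
    have "L y i * ?Th y \<le> L y k" if y: "y \<in> I" for y
    proof (cases "k = i")
      case True
      have "L y i * ?Th y \<le> L y i * 1"
        using Th(2)[OF y] bary_nonneg[OF I_subset_T[OF y]] by (intro mult_left_mono) auto
      then show ?thesis using True by simp
    next
      case False
      have pos: "L y i > 0" "L y k > 0" using y by (auto simp: I_iff)
      have "L y i * ?Th y \<le> L y i * ratio k i y"
        using Theta_le_ratio[OF y, of k ?J i] False pos by (intro mult_left_mono) auto
      also have "\<dots> \<le> L y k"
        using pos by (simp add: ratio_def divide_simps)
      finally show ?thesis .
    qed
    moreover have "0 \<le> L y i * ?Th y" if "y \<in> I" for y
      using G that bary_nonneg[OF I_subset_T] by auto
    moreover have "((\<lambda>y. L y k) \<longlongrightarrow> 0) (at x within I)"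
      using bary_tendsto[of k x I] by (simp add: k)
    ultimately show ?thesis by (intro tendsto_squeeze_I[of "\<lambda>y. L y i * ?Th y"]) auto
  qed
  show ?thesis
    unfolding lift_def
  proof (rule jetI[OF der])
    fix k
    have "((\<lambda>x. 1 / ?d * (L x i * ?Th x) * F (L x)) \<longlongrightarrow> 1 / ?d * 0 * F (L (v k))) (at (v k) within I)"
      by (intro tendsto_intros wTh vertex_boundary form_tendsto[OF F] boundary_T)
    then show "((\<lambda>x. L x i / ?d * ?Th x * F (L x)) \<longlongrightarrow> 0) (at (v k) within I)"
      by (simp add: mult.assoc)
  next
    fix x assume x: "x \<in> boundary"
    have 1: "((\<lambda>y. (L y i * ?Th y) *\<^sub>R H y) \<longlongrightarrow> 0) (at x within I)"
      by (rule tendsto_bounded_zero[OF wTh[OF x]]) (use H in simp)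
    have Ft: "((\<lambda>y. F (L y)) \<longlongrightarrow> F (L x)) (at x within I)"
      by (rule form_tendsto[OF F boundary_T[OF x]])
    have "((\<lambda>y. F (L y) *\<^sub>R (L y i *\<^sub>R G y)) \<longlongrightarrow> 0) (at x within I) \<and>
      ((\<lambda>y. F (L y) *\<^sub>R (?Th y *\<^sub>R g i)) \<longlongrightarrow> (if L x i = 0 then F (L x) *\<^sub>R g i else 0)) (at x within I)"
    proof (cases "\<exists>k. k \<noteq> i \<and> L x k = 0")
      case True
      then have "F (L x) = 0" using form_vanishes[OF F] by blast
      then have F0: "((\<lambda>y. F (L y)) \<longlongrightarrow> 0) (at x within I)" using Ft by simp
      have "norm (?Th y *\<^sub>R g i) \<le> norm (g i)" if "y \<in> I" for y
        using mult_right_mono[OF Th(2)[OF that], of "norm (g i)"] by simp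
      then have "((\<lambda>y. F (L y) *\<^sub>R (?Th y *\<^sub>R g i)) \<longlongrightarrow> 0) (at x within I)"
        by (rule tendsto_bounded_zero[OF F0])
      moreover have "((\<lambda>y. F (L y) *\<^sub>R (L y i *\<^sub>R G y)) \<longlongrightarrow> 0) (at x within I)"
        by (rule tendsto_bounded_zero[OF F0 Th(3)])
      moreover have "(if L x i = 0 then F (L x) *\<^sub>R g i else 0) = 0"
        using \<open>F (L x) = 0\<close> by simp
      ultimately show ?thesis by (simp only: simp_thms)
    next
      case False
      then have pos: "\<forall>j\<in>?J. L x j > 0"
        using bary_nonneg[OF boundary_T[OF x]] by (metis DiffE insertI1 less_eq_real_def)
      then have "L x i = 0"
        using x by (auto simp: boundary_def face_def) (metis False)
      then have th: "(?Th \<longlongrightarrow> 1) (at x within I)" "((\<lambda>y. L y i *\<^sub>R G y) \<longlongrightarrow> 0) (at x within I)"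
        using lim pos by auto
      have "((\<lambda>y. F (L y) *\<^sub>R (L y i *\<^sub>R G y)) \<longlongrightarrow> F (L x) *\<^sub>R 0) (at x within I)"
        "((\<lambda>y. F (L y) *\<^sub>R (?Th y *\<^sub>R g i)) \<longlongrightarrow> F (L x) *\<^sub>R (1 *\<^sub>R g i)) (at x within I)"
        by (intro tendsto_intros Ft th)+
      then show ?thesis using \<open>L x i = 0\<close> by simp
    qed
    then have "(D \<longlongrightarrow> (1 / ?d) *\<^sub>R (0 + 0 + (if L x i = 0 then F (L x) *\<^sub>R g i else 0))) (at x within I)"
      unfolding D_def[abs_def] by (intro tendsto_intros 1) auto
    then show "(D \<longlongrightarrow> (if L x i = 0 then (F (L x) / ?d) *\<^sub>R g i else 0)) (at x within I)"
      by (auto split: if_splits)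
  qed
qed

end

section \<open>Polynomials in barycentric coordinates\<close>

definition monomial :: "(3 \<Rightarrow> nat) \<Rightarrow> real^3 \<Rightarrow> real" where
  "monomial a x = (\<Prod>j\<in>UNIV. (x $ j) ^ a j)"

lemma polys_eq: "polys k = span {monomial a | a. (\<Sum>j\<in>UNIV. a j) \<le> k}"
  unfolding polys_def monomial_def[abs_def] ..

lemma subspace_polys: "subspace (polys k)"
  by (simp add: polys_eq)

lemma polys_add: "p \<in> polys k \<Longrightarrow> q \<in> polys k \<Longrightarrow> (\<lambda>x. p x + q x) \<in> polys k"
  using subspace_add[OF subspace_polys] by (simp add: plus_fun_def)

lemma polys_scale: "p \<in> polys k \<Longrightarrow> (\<lambda>x. c * p x) \<in> polys k"
  using subspace_scale[OF subspace_polys, of p k c] by (simp add: scaleR_fun_def)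

lemma polys_sum: "(\<And>t. t \<in> A \<Longrightarrow> p t \<in> polys k) \<Longrightarrow> (\<lambda>x. \<Sum>t\<in>A. p t x) \<in> polys k"
  using subspace_sum[OF subspace_polys, of A p k] by (simp add: sum_fun_apply[abs_def])

lemma polys_mult:
  assumes "p \<in> polys k" "q \<in> polys l"
  shows "(\<lambda>x. p x * q x) \<in> polys (k + l)"
  using assms(1) unfolding polys_eq[of k]
proof (induction rule: span_induct_alt)
  case base
  then show ?case using subspace_0[OF subspace_polys] by (simp add: zero_fun_def)
next
  case (step c m p)
  then obtain a where a: "m = monomial a" "(\<Sum>j\<in>UNIV. a j) \<le> k" by blast
  have "(\<lambda>x. m x * q x) \<in> polys (k + l)"
    using assms(2) unfolding polys_eq[of l]
  proof (induction rule: span_induct_alt)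
    case base
    then show ?case using subspace_0[OF subspace_polys] by (simp add: zero_fun_def)
  next
    case (step d m' r)
    then obtain b where b: "m' = monomial b" "(\<Sum>j\<in>UNIV. b j) \<le> l" by blast
    have "monomial (\<lambda>j. a j + b j) \<in> polys (k + l)"
      unfolding polys_eq using a b by (intro span_base) (auto simp: sum.distrib intro!: exI[of _ "\<lambda>j. a j + b j"])
    moreover have "monomial (\<lambda>j. a j + b j) = (\<lambda>x. m x * m' x)"
      by (simp add: a b monomial_def fun_eq_iff power_add prod.distrib)
    ultimately have "(\<lambda>x. d * (m x * m' x) + m x * r x) \<in> polys (k + l)"
      using step by (intro polys_add polys_scale) auto
    then show ?case by (simp add: scaleR_fun_def algebra_simps)
  qed
  then have "(\<lambda>x. c * (m x * q x) + p x * q x) \<in> polys (k + l)"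
    using step by (intro polys_add polys_scale)
  then show ?case by (simp add: scaleR_fun_def algebra_simps)
qed

lemma polys_const: "(\<lambda>x. c) \<in> polys k"
proof -
  have "monomial (\<lambda>j. 0) \<in> polys k"
    unfolding polys_eq by (intro span_base) (auto intro!: exI[of _ "\<lambda>j. 0"])
  from polys_scale[OF this, of c] show ?thesis by (simp add: monomial_def)
qed

lemma polys_mono: "k \<le> l \<Longrightarrow> p \<in> polys k \<Longrightarrow> p \<in> polys l"
  using polys_mult[of p k "\<lambda>x. 1" "l - k", OF _ polys_const] by simp

lemma polys_component: "(\<lambda>x. x $ i) \<in> polys 1"
proof -
  have "monomial (\<lambda>j. if j = i then 1 else 0) \<in> polys 1"
    unfolding polys_eq by (intro span_base) (auto intro!: exI[of _ "\<lambda>j. if j = i then 1 else 0"])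
  moreover have "monomial (\<lambda>j. if j = i then 1 else 0) = (\<lambda>x. x $ i)"
    by (simp add: monomial_def fun_eq_iff if_distrib[of "\<lambda>n. _ ^ n"] cong: if_cong)
  ultimately show ?thesis by simp
qed

text \<open>Splitting off one variable lets a monomial of degree two be treated as a product of two of degree at
most one.\<close>

lemma monomial_reduce:
  assumes "(\<Sum>j\<in>UNIV. a j) \<le> Suc k"
  shows "(\<Sum>j\<in>UNIV. a j) \<le> k \<or> (\<exists>j b. (\<Sum>j\<in>UNIV. b j) \<le> k \<and> (\<forall>x. monomial a x = x $ j * monomial b x))"
proof (cases "\<forall>j. a j = 0")
  case True
  then show ?thesis by simp
next
  case False
  then obtain j where j: "a j > 0" by auto
  define b where "b = a(j := a j - 1)"
  have "(\<Sum>j\<in>UNIV. a j) = a j + (\<Sum>j\<in>UNIV - {j}. a j)" by (rule sum.remove) auto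
  moreover have "(\<Sum>j\<in>UNIV. b j) = b j + (\<Sum>j\<in>UNIV - {j}. b j)" by (rule sum.remove) auto
  moreover have "(\<Sum>j\<in>UNIV - {j}. b j) = (\<Sum>j\<in>UNIV - {j}. a j)"
    by (rule sum.cong) (auto simp: b_def)
  ultimately have "(\<Sum>j\<in>UNIV. b j) \<le> k" using assms j by (simp add: b_def)
  moreover have "monomial a x = x $ j * monomial b x" for x
  proof -
    have "monomial a x = (x $ j) ^ a j * (\<Prod>j\<in>UNIV - {j}. (x $ j) ^ a j)"
      unfolding monomial_def by (rule prod.remove) auto
    also have "(\<Prod>j\<in>UNIV - {j}. (x $ j) ^ a j) = (\<Prod>j\<in>UNIV - {j}. (x $ j) ^ b j)"
      by (rule prod.cong) (auto simp: b_def)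
    also have "(x $ j) ^ a j = x $ j * (x $ j) ^ b j"
      using j by (simp add: b_def flip: power_Suc)
    also have "x $ j * (x $ j) ^ b j * (\<Prod>j\<in>UNIV - {j}. (x $ j) ^ b j) = x $ j * monomial b x"
      unfolding monomial_def by (simp only: prod.remove[OF finite UNIV_I[of j], of "\<lambda>j. (x $ j) ^ b j"] mult.assoc)
    finally show ?thesis .
  qed
  ultimately show ?thesis by blast
qed

lemma linear_on_set: "linear (on_set S)"
  by (rule linearI) (simp_all add: on_set_def fun_eq_iff scaleR_fun_def)

lemma subspace_polys_on: "subspace (polys_on S k)"
  unfolding polys_on_def by (rule linear_subspace_image[OF linear_on_set subspace_polys])

lemma polys_onI: "p \<in> polys k \<Longrightarrow> on_set S p \<in> polys_on S k"
  by (simp add: polys_on_def)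

context tetra
begin

lemma bary_polys: "(\<lambda>x. L x j) \<in> polys 1"
proof -
  have "(\<lambda>x. L x j) = (\<lambda>x. L 0 j + (\<Sum>k\<in>UNIV. g j $ k * x $ k))"
  proof
    show "L x j = L 0 j + (\<Sum>k\<in>UNIV. g j $ k * x $ k)" for x
      using bary_affine[of x j 0] by (simp add: inner_vec_def)
  qed
  moreover have "(\<lambda>x. L 0 j + (\<Sum>k\<in>UNIV. g j $ k * x $ k)) \<in> polys 1"
    by (intro polys_add polys_const polys_sum polys_scale polys_component)
  ultimately show ?thesis by (rule ssubst[where P = "\<lambda>f. f \<in> polys 1"])
qed

lemma bary_product_polys: "(\<lambda>x. L x i * L x j) \<in> polys 2"
  using polys_mult[OF bary_polys bary_polys] by (simp add: numeral_2_eq_2)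

text \<open>An affine function has a homogeneous representation, because the coordinates sum to one; likewise
for quadratic functions below.\<close>

definition affine_form where "affine_form p \<longleftrightarrow> (\<exists>c. \<forall>x. p x = (\<Sum>j\<in>UNIV. c j * L x j))"
definition quadratic_form where
  "quadratic_form p \<longleftrightarrow> (\<exists>A. \<forall>x. p x = (\<Sum>i\<in>UNIV. \<Sum>j\<in>UNIV. A i j * (L x i * L x j)))"

lemma affine_form_const: "affine_form (\<lambda>x. c)"
  unfolding affine_form_def by (intro exI[of _ "\<lambda>j. c"]) (simp add: bary_props flip: sum_distrib_left)

lemma affine_form_component: "affine_form (\<lambda>x. x $ k)"
  unfolding affine_form_def
proof (intro exI allI)
  fix x
  have "x $ k = (\<Sum>j\<in>UNIV. L x j *\<^sub>R v j) $ k" by (simp add: bary_props)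
  also have "\<dots> = (\<Sum>j\<in>UNIV. v j $ k * L x j)" by (simp add: mult.commute)
  finally show "x $ k = (\<Sum>j\<in>UNIV. v j $ k * L x j)" .
qed

lemma affine_form_lincomb:
  assumes "affine_form p" "affine_form q"
  shows "affine_form (c *\<^sub>R p + q)"
proof -
  obtain a b where "\<And>x. p x = (\<Sum>j\<in>UNIV. a j * L x j)" "\<And>x. q x = (\<Sum>j\<in>UNIV. b j * L x j)"
    using assms unfolding affine_form_def by blast
  then show ?thesis unfolding affine_form_def
    by (intro exI[of _ "\<lambda>j. c * a j + b j"])
      (simp add: scaleR_fun_def sum_distrib_left sum.distrib algebra_simps)
qed

lemma quadratic_form_lincomb:
  assumes "quadratic_form p" "quadratic_form q"
  shows "quadratic_form (c *\<^sub>R p + q)"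
proof -
  obtain A B where "\<And>x. p x = (\<Sum>i\<in>UNIV. \<Sum>j\<in>UNIV. A i j * (L x i * L x j))"
    "\<And>x. q x = (\<Sum>i\<in>UNIV. \<Sum>j\<in>UNIV. B i j * (L x i * L x j))"
    using assms unfolding quadratic_form_def by blast
  then show ?thesis unfolding quadratic_form_def
    by (intro exI[of _ "\<lambda>i j. c * A i j + B i j"])
      (simp add: scaleR_fun_def sum_distrib_left sum.distrib distrib_right mult.assoc)
qed

lemma quadratic_form_mult:
  assumes "affine_form p" "affine_form q"
  shows "quadratic_form (\<lambda>x. p x * q x)"
proof -
  obtain a b where "\<And>x. p x = (\<Sum>j\<in>UNIV. a j * L x j)" "\<And>x. q x = (\<Sum>j\<in>UNIV. b j * L x j)"
    using assms unfolding affine_form_def by blast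
  then show ?thesis unfolding quadratic_form_def
    by (intro exI[of _ "\<lambda>i j. a i * b j"]) (simp add: sum_product mult_ac)
qed

lemma affine_form_monomial:
  assumes "(\<Sum>j\<in>UNIV. a j) \<le> 1"
  shows "affine_form (monomial a)"
proof -
  have const: "affine_form (monomial b)" "monomial b = (\<lambda>x. 1)" if "(\<Sum>j\<in>UNIV. b j) \<le> 0" for b
  proof -
    show "monomial b = (\<lambda>x. 1)" using that by (simp add: monomial_def fun_eq_iff)
    then show "affine_form (monomial b)" using affine_form_const by simp
  qed
  from monomial_reduce[of a 0] assms consider "(\<Sum>j\<in>UNIV. a j) \<le> 0"
    | j b where "(\<Sum>j\<in>UNIV. b j) \<le> 0" "\<And>x. monomial a x = x $ j * monomial b x" by auto
  then show ?thesis
  proof cases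
    case 1
    then show ?thesis by (rule const)
  next
    case 2
    then have "monomial a = (\<lambda>x. x $ j)" using const by (simp add: fun_eq_iff)
    then show ?thesis using affine_form_component by simp
  qed
qed

lemma quadratic_form_monomial:
  assumes "(\<Sum>j\<in>UNIV. a j) \<le> 2"
  shows "quadratic_form (monomial a)"
proof -
  from monomial_reduce[of a 1] assms consider "(\<Sum>j\<in>UNIV. a j) \<le> 1"
    | j b where "(\<Sum>j\<in>UNIV. b j) \<le> 1" "\<And>x. monomial a x = x $ j * monomial b x"
    by (auto simp: numeral_2_eq_2)
  then show ?thesis
  proof cases
    case 1
    then show ?thesis
      using quadratic_form_mult[OF affine_form_monomial[OF 1] affine_form_const[of 1]] by simp
  next
    case 2
    then have "monomial a = (\<lambda>x. x $ j * monomial b x)" by (simp add: fun_eq_iff)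
    then show ?thesis
      using quadratic_form_mult[OF affine_form_component affine_form_monomial[OF 2(1)]] by simp
  qed
qed

lemma affine_form_polys:
  assumes "p \<in> polys 1" shows "affine_form p"
  using assms unfolding polys_eq
proof (induction rule: span_induct_alt)
  case base
  show ?case unfolding zero_fun_def by (rule affine_form_const)
next
  case (step c x y)
  then show ?case using affine_form_monomial affine_form_lincomb by blast
qed

lemma quadratic_form_polys:
  assumes "p \<in> polys 2" shows "quadratic_form p"
  using assms unfolding polys_eq
proof (induction rule: span_induct_alt)
  case base
  show ?case unfolding zero_fun_def
    using quadratic_form_mult[OF affine_form_const[of 0] affine_form_const[of 0]] by simp
next
  case (step c x y)
  then show ?case using quadratic_form_monomial quadratic_form_lincomb by blast
qed

definition edge_midpt where "edge_midpt i j = (1/2::real) *\<^sub>R (v i + v j)"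

lemma bary_edge_midpt: "L (edge_midpt i j) k = ((if k = i then 1 else 0) + (if k = j then 1 else 0)) / 2"
proof -
  have "L (edge_midpt i j) = (\<lambda>k. ((if k = i then 1 else 0) + (if k = j then 1 else 0)) / 2)"
  proof (rule bary_eqI)
    show "(\<Sum>k\<in>UNIV. ((if k = i then 1 else 0) + (if k = j then 1 else 0)) / 2) = (1::real)"
      by (simp add: sum.distrib flip: sum_divide_distrib)
    have "(\<Sum>k\<in>UNIV. (((if k = i then 1 else 0) + (if k = j then 1 else 0)) / 2) *\<^sub>R v k)
      = (\<Sum>k\<in>UNIV. (if k = i then (1/2) *\<^sub>R v k else 0) + (if k = j then (1/2) *\<^sub>R v k else 0))"
      by (rule sum.cong) (auto simp: add_divide_distrib scaleR_left_distrib)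
    then show "(\<Sum>k\<in>UNIV. (((if k = i then 1 else 0) + (if k = j then 1 else 0)) / 2) *\<^sub>R v k) = edge_midpt i j"
      by (simp add: sum.distrib edge_midpt_def scaleR_right_distrib)
  qed
  then show ?thesis by simp
qed

lemma edge_midpt_face: "i \<noteq> k \<Longrightarrow> j \<noteq> k \<Longrightarrow> edge_midpt i j \<in> face v k"
  by (simp add: face_def T_iff bary_edge_midpt)

lemma affine_edge_midpt:
  assumes "p \<in> polys 1"
  shows "p (edge_midpt i j) = (p (v i) + p (v j)) / 2"
proof -
  obtain c where c: "\<And>x. p x = (\<Sum>j\<in>UNIV. c j * L x j)"
    using affine_form_polys[OF assms] unfolding affine_form_def by blast
  have v: "p (v i) = c i" for i by (simp add: c bary_vertex if_distrib[of "\<lambda>t. _ * t"] cong: if_cong)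
  have "p (edge_midpt i j) = (\<Sum>k\<in>UNIV. (if k = i then c k / 2 else 0) + (if k = j then c k / 2 else 0))"
    unfolding c by (rule sum.cong) (auto simp: bary_edge_midpt)
  also have "\<dots> = (c i + c j) / 2" by (simp add: sum.distrib add_divide_distrib)
  finally show ?thesis by (simp add: v)
qed

text \<open>The values at the midpoints, with \<open>i = j\<close> giving the vertices, determine the symmetrised coefficients
that belong to the face.\<close>

lemma quadratic_zero_on_face:
  assumes p: "p \<in> polys 2"
    and zero: "\<And>i j. i \<noteq> k \<Longrightarrow> j \<noteq> k \<Longrightarrow> p (edge_midpt i j) = 0"
    and x: "x \<in> face v k"
  shows "p x = 0"
proof -
  obtain A where A: "\<And>x. p x = (\<Sum>i\<in>UNIV. \<Sum>j\<in>UNIV. A i j * (L x i * L x j))"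
    using quadratic_form_polys[OF p] unfolding quadratic_form_def by blast
  have if_mult: "(if P then 1 else 0) * t = (if P then t else 0)" "t * (if P then 1 else 0) = (if P then t else 0)" for P and t :: real
    by auto
  have mid: "p (edge_midpt i j) = (A i i + A i j + A j i + A j j) / 4" for i j
  proof -
    have "p (edge_midpt i j) = (\<Sum>a\<in>UNIV. \<Sum>b\<in>UNIV. A a b / 4 * ((if a = i then 1 else 0) + (if a = j then 1 else 0)) * ((if b = i then 1 else 0) + (if b = j then 1 else 0)))"
      unfolding A bary_edge_midpt by (intro sum.cong) auto
    also have "\<dots> = (A i i + A i j + A j i + A j j) / 4"
      by (simp add: distrib_left distrib_right sum.distrib if_mult add_divide_distrib cong: if_cong)
    finally show ?thesis .
  qed
  have sym: "(A i j + A j i) * (L x i * L x j) = 0" for i j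
  proof (cases "i = k \<or> j = k")
    case True
    then show ?thesis using x by (auto simp: face_def)
  next
    case False
    then show ?thesis using zero[of i j] zero[of i i] zero[of j j] mid[of i j] mid[of i i] mid[of j j] by simp
  qed
  \<comment> \<open>Only symmetrised coefficients are known to vanish, hence the detour over \<open>2 * p x\<close>.\<close>
  have "2 * p x = p x + (\<Sum>j\<in>UNIV. \<Sum>i\<in>UNIV. A i j * (L x i * L x j))"
    unfolding A by (subst sum.swap) simp
  also have "\<dots> = (\<Sum>i\<in>UNIV. \<Sum>j\<in>UNIV. (A i j + A j i) * (L x i * L x j))"
    unfolding A by (simp add: sum.distrib[symmetric] algebra_simps)
  also have "\<dots> = 0" by (simp add: sym)
  finally show ?thesis by simp
qed

end

section \<open>The edge part of a normal trace and its lift\<close>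

context tetra
begin

lemma form_zero_at_edge_midpt:
  assumes "F \<in> Phi_forms k" "i \<noteq> k" "j \<noteq> k"
  shows "F (L (edge_midpt i j)) = 0"
proof -
  have "card {i, j, k} \<le> 3" by (simp add: card_insert_if)
  moreover have "card (UNIV :: 4 set) = 4" by simp
  ultimately have "{i, j, k} \<noteq> UNIV" by auto
  then obtain m where "m \<noteq> i" "m \<noteq> j" "m \<noteq> k" by auto
  then show ?thesis by (intro form_vanishes[OF assms(1)]) (auto simp: bary_edge_midpt)
qed

lemma subspace_Phi_forms: "subspace (Phi_forms k)"
  by (simp add: Phi_forms_def)

text \<open>Two splittings differ by a quadratic polynomial that equals an element of the span of the \<open>\<Phi>\<close> on the
face; it vanishes on the edges of the face, hence everywhere on the face.\<close>

lemma q_part_eq: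
  assumes F: "F \<in> Phi_forms k" and p: "p \<in> polys 2"
    and eq: "normal_trace v k z = on_set (face v k) p + on_set (face v k) (\<lambda>x. F (L x))"
  shows "q_part v k z = on_set (face v k) (\<lambda>x. F (L x))"
  unfolding q_part_def
proof (rule the_equality)
  show "on_set (face v k) (\<lambda>x. F (L x)) \<in> Q_edge v k \<and>
    (\<exists>r\<in>polys_on (face v k) 2. normal_trace v k z = r + on_set (face v k) (\<lambda>x. F (L x)))"
    using F p eq polys_onI unfolding Q_edge_def by blast
next
  fix q
  assume "q \<in> Q_edge v k \<and> (\<exists>r\<in>polys_on (face v k) 2. normal_trace v k z = r + q)"
  then obtain F' p' where F': "F' \<in> Phi_forms k" "q = on_set (face v k) (\<lambda>x. F' (L x))"
    and p': "p' \<in> polys 2" "normal_trace v k z = on_set (face v k) p' + q"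
    unfolding Q_edge_def polys_on_def by blast
  have sum_eq: "p x + F (L x) = p' x + F' (L x)" if "x \<in> face v k" for x
    using eq p'(2) that unfolding F'(2) on_set_add by (metis on_set_eqD)
  have diff: "(\<lambda>x. p x - p' x) \<in> polys 2"
    using polys_add[OF p polys_scale[OF p'(1), of "-1"]] by simp
  have "p x - p' x = 0" if "x \<in> face v k" for x
  proof (rule quadratic_zero_on_face[OF diff _ that])
    fix i j assume ij: "i \<noteq> k" "j \<noteq> k"
    show "p (edge_midpt i j) - p' (edge_midpt i j) = 0"
      using sum_eq[OF edge_midpt_face[OF ij]] form_zero_at_edge_midpt[OF F ij] form_zero_at_edge_midpt[OF F'(1) ij] by simp
  qed
  then show "q = on_set (face v k) (\<lambda>x. F (L x))"
    unfolding F'(2) by (intro on_set_cong) (use sum_eq in fastforce)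
qed

text \<open>Setting the coordinate \<open>k\<close> to zero and rescaling the others to sum one moves an interior point to
the face; by homogeneity this changes the value only by a known factor.\<close>

lemma form_determined_by_face:
  assumes F: "F \<in> Phi_forms k" "F' \<in> Phi_forms k"
    and eq: "on_set (face v k) (\<lambda>x. F (L x)) = on_set (face v k) (\<lambda>x. F' (L x))"
    and x: "x \<in> I"
  shows "F (L x) = F' (L x)"
proof -
  define s where "s = (\<Sum>j\<in>UNIV - {k}. L x j)"
  obtain j where "j \<noteq> k" using ex_index_outside_pair by blast
  then have s: "s > 0" unfolding s_def using x by (intro sum_pos) (auto simp: I_iff)
  define \<mu> where "\<mu> j = (if j = k then 0 else L x j / s)" for j
  have "(\<Sum>j\<in>UNIV. \<mu> j) = (\<Sum>j\<in>UNIV - {k}. L x j / s)"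
    by (rule sum.mono_neutral_cong_right) (auto simp: \<mu>_def)
  then have "(\<Sum>j\<in>UNIV. \<mu> j) = 1" using s by (simp add: s_def flip: sum_divide_distrib)
  then have L: "L (\<Sum>j\<in>UNIV. \<mu> j *\<^sub>R v j) = \<mu>" by (rule bary_combination)
  moreover have "(\<Sum>j\<in>UNIV. \<mu> j *\<^sub>R v j) \<in> face v k"
    using L s x by (auto simp: face_def T_iff \<mu>_def I_iff less_imp_le)
  ultimately have "F \<mu> = F' \<mu>" using on_set_eqD[OF eq] by metis
  moreover have "F (L x) = s\<^sup>2 * F \<mu>" "F' (L x) = s\<^sup>2 * F' \<mu>"
    using form_homogeneous[OF F(1), of s "L x"] form_homogeneous[OF F(2), of s "L x"] s
    unfolding \<mu>_def[abs_def] by simp_all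
  ultimately show ?thesis by simp
qed

lemma normal_lift_eq:
  assumes F: "F \<in> Phi_forms k"
  shows "normal_lift v k (on_set (face v k) (\<lambda>x. F (L x))) = lift k F"
proof -
  have ext: "bary_extension v k (on_set (face v k) (\<lambda>x. F (L x))) = on_set I (\<lambda>x. F (L x))"
    unfolding bary_extension_def
  proof (rule the_equality)
    fix h
    assume "\<exists>F'\<in>Phi_forms k. on_set (face v k) (\<lambda>x. F (L x)) = on_set (face v k) (\<lambda>x. F' (L x)) \<and>
      h = on_set I (\<lambda>x. F' (L x))"
    then show "h = on_set I (\<lambda>x. F (L x))"
      using form_determined_by_face[OF F] by (auto intro: on_set_cong)
  qed (use F in blast)
  show ?thesis
    unfolding normal_lift_def lift_def ext Theta_def
    by (rule on_set_cong) (simp add: on_set_def)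
qed

definition bubble_edge_part :: "4 \<times> 4 \<times> 4 \<times> 4 \<Rightarrow> (4 \<Rightarrow> real) \<Rightarrow> real" where
  "bubble_edge_part = (\<lambda>(i, l, m, n). dcoef v l i *\<^sub>R Phi_l l m n + dcoef v m i *\<^sub>R Phi_m l m n + dcoef v n i *\<^sub>R Phi_n l m n)"

text \<open>The non-polynomial part of the normal trace on the face \<open>k\<close> of the combination of bubbles with
coefficients \<open>c\<close>.\<close>

definition edge_part :: "(4 \<times> 4 \<times> 4 \<times> 4 \<Rightarrow> real) \<Rightarrow> 4 \<Rightarrow> (4 \<Rightarrow> real) \<Rightarrow> real" where
  "edge_part c k = (\<Sum>t\<in>bubble_indices. (if fst t = k then c t else 0) *\<^sub>R bubble_edge_part t)"

lemma edge_part_in: "edge_part c k \<in> Phi_forms k"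
  unfolding edge_part_def
proof (rule subspace_sum[OF subspace_Phi_forms])
  fix t assume "t \<in> bubble_indices"
  then obtain i l m n where t: "t = (i, l, m, n)" "l < m" "{i, l, m, n} = UNIV" by (auto simp: bubble_indices_def)
  show "(if fst t = k then c t else 0) *\<^sub>R bubble_edge_part t \<in> Phi_forms k"
  proof (cases "i = k")
    case True
    have "{Phi_l l m n, Phi_m l m n, Phi_n l m n} \<subseteq> Phi_forms k"
      unfolding Phi_forms_def using t True by (intro subsetI span_base) blast
    then have "bubble_edge_part t \<in> Phi_forms k"
      unfolding t(1) bubble_edge_part_def prod.case
      by (intro subspace_add[OF subspace_Phi_forms] subspace_scale[OF subspace_Phi_forms]) auto
    then show ?thesis by (intro subspace_scale[OF subspace_Phi_forms])
  next
    case False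
    then show ?thesis using t subspace_0[OF subspace_Phi_forms] by simp
  qed
qed

definition bubble where "bubble = (\<lambda>(i::4, l, m, n). edge_bubble v l m n)"

definition bubble_grad where
  "bubble_grad = (\<lambda>(i::4, l, m, n) x. Phi_l l m n (L x) *\<^sub>R g l + Phi_m l m n (L x) *\<^sub>R g m
      + (Phi_n l m n (L x) + L x l * L x m) *\<^sub>R g n)"

definition edge_product where "edge_product = (\<lambda>(i::4, l, m, n::4) x. L x l * L x m)"

text \<open>The other bubble of the edge \<open>[v\<^sub>l, v\<^sub>m]\<close>.\<close>

definition opposite where "opposite = (\<lambda>(i::4, l::4, m::4, n::4). (n, l, m, i))"

lemma opposite_opposite: "opposite (opposite t) = t"
  by (simp add: opposite_def split: prod.splits)

lemma opposite_bubble_indices: "t \<in> bubble_indices \<Longrightarrow> opposite t \<in> bubble_indices"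
  by (auto simp: bubble_indices_def opposite_def)

lemma bubble_indices_cases:
  assumes "t \<in> bubble_indices"
  obtains i l m n where "t = (i, l, m, n)" "l < m" "{i, l, m, n} = UNIV" "distinct [i, l, m, n]"
proof -
  obtain i l m n where "t = (i, l, m, n)" by (metis surj_pair)
  then show thesis using assms that[of i l m n] four_indices_distinct[of i l m n] by (simp add: bubble_indices_def)
qed

lemma bubble_jet: "t \<in> bubble_indices \<Longrightarrow> jet (bubble t) (\<lambda>_. 0) (bubble_grad t)"
  using edge_bubble_jet by (auto simp: bubble_indices_def bubble_def bubble_grad_def)

lemma finite_bubble_indices: "finite bubble_indices"
  by (rule finite_subset[OF subset_UNIV]) simp

text \<open>By the formula for the gradient, the trace vanishes on the faces \<open>l\<close> and \<open>m\<close>; on the face \<open>n\<close> only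
\<open>\<lambda>\<^sub>l\<lambda>\<^sub>m\<close> remains of the partial derivatives.\<close>

lemma bubble_trace:
  assumes t: "t \<in> bubble_indices" and x: "x \<in> face v k"
  shows "bubble_grad t x \<bullet> outer_normal v k
    = (if fst (opposite t) = k then dcoef v k k * edge_product t x else 0)
    + (if fst t = k then dcoef v (fst (opposite t)) k * edge_product t x + bubble_edge_part t (L x) else 0)"
proof -
  obtain i l m n where t': "t = (i, l, m, n)" and U: "{i, l, m, n} = UNIV" using t by (auto simp: bubble_indices_def)
  have d: "distinct [i, l, m, n]" by (rule four_indices_distinct[OF U])
  have k0: "L x k = 0" using x by (simp add: face_def)
  have lhs: "bubble_grad t x \<bullet> outer_normal v k = Phi_l l m n (L x) * dcoef v l k + Phi_m l m n (L x) * dcoef v m k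
      + (Phi_n l m n (L x) + L x l * L x m) * dcoef v n k"
    by (simp add: t' bubble_grad_def inner_add_left dcoef_normal)
  have "k \<in> {i, l, m, n}" using U by simp
  then consider "k = i" | "k = l" | "k = m" | "k = n" by blast
  then show ?thesis
  proof cases
    case 1
    then show ?thesis using d unfolding lhs
      by (auto simp: t' opposite_def edge_product_def bubble_edge_part_def scaleR_fun_def algebra_simps)
  next
    case 2
    then show ?thesis using d k0 unfolding lhs
      by (auto simp: t' opposite_def Phi_l_def Phi_m_def Phi_n_def)
  next
    case 3
    then show ?thesis using d k0 unfolding lhs
      by (auto simp: t' opposite_def Phi_l_def Phi_m_def Phi_n_def)
  next
    case 4
    then have "Phi_n l m n (L x) = 0" using k0 by (auto simp: Phi_n_def power2_eq_square)
    then show ?thesis using d k0 4 unfolding lhs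
      by (auto simp: t' opposite_def edge_product_def Phi_l_def Phi_m_def)
  qed
qed

text \<open>These are dual to the vertex gradients: the gradient at \<open>v\<^sub>i\<close> is \<open>g\<^sub>j\<close>, and it is zero at the other
vertices.  For \<open>i = j\<close> the formula is \<open>\<lambda>\<^sub>i\<^sup>2 / 2\<close>, which carries the value at \<open>v\<^sub>i\<close>.\<close>

definition nodal where
  "nodal = (\<lambda>(i, j). on_set I (\<lambda>x. (1/2) * (L x i * L x j + L x i * L x i * L x j - L x j * L x j * L x i)))"

definition nodal_grad where
  "nodal_grad = (\<lambda>(i, j) x. (1/2) *\<^sub>R ((L x i + L x i * L x i - 2 * (L x i * L x j)) *\<^sub>R g j
     + (L x j + 2 * (L x i * L x j) - L x j * L x j) *\<^sub>R g i))"

lemma nodal_jet: "jet (nodal p) (\<lambda>i. if p = (i, i) then 1/2 else 0) (nodal_grad p)"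
proof -
  obtain i j where p: "p = (i, j)" by (cases p)
  show ?thesis
    unfolding p nodal_def nodal_grad_def prod.case
  proof (rule jetI)
    fix x
    show "GDERIV (\<lambda>x. (1/2) * (L x i * L x j + L x i * L x i * L x j - L x j * L x j * L x i)) x :>
      (1/2) *\<^sub>R ((L x i + L x i * L x i - 2 * (L x i * L x j)) *\<^sub>R g j
     + (L x j + 2 * (L x i * L x j) - L x j * L x j) *\<^sub>R g i)"
      unfolding gderiv_def
      by (auto intro!: derivative_eq_intros GDERIV_bary[unfolded gderiv_def]
        simp: inner_add_right fun_eq_iff algebra_simps add_divide_distrib)
  next
    fix k
    have "((\<lambda>x. (1/2) * (L x i * L x j + L x i * L x i * L x j - L x j * L x j * L x i)) \<longlongrightarrow>
      (1/2) * (L (v k) i * L (v k) j + L (v k) i * L (v k) i * L (v k) j - L (v k) j * L (v k) j * L (v k) i)) (at (v k) within I)"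
      by (intro tendsto_intros)
    moreover have "(1/2) * (L (v k) i * L (v k) j + L (v k) i * L (v k) i * L (v k) j - L (v k) j * L (v k) j * L (v k) i)
      = (if (i, j) = (k, k) then 1/2 else 0)"
      by (auto simp: bary_vertex)
    ultimately show "((\<lambda>x. (1/2) * (L x i * L x j + L x i * L x i * L x j - L x j * L x j * L x i)) \<longlongrightarrow>
      (if (i, j) = (k, k) then 1/2 else 0)) (at (v k) within I)" by (simp only:)
  next
    fix x
    show "((\<lambda>x. (1/2) *\<^sub>R ((L x i + L x i * L x i - 2 * (L x i * L x j)) *\<^sub>R g j
     + (L x j + 2 * (L x i * L x j) - L x j * L x j) *\<^sub>R g i)) \<longlongrightarrow>
       (1/2) *\<^sub>R ((L x i + L x i * L x i - 2 * (L x i * L x j)) *\<^sub>R g j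
     + (L x j + 2 * (L x i * L x j) - L x j * L x j) *\<^sub>R g i)) (at x within I)"
      by (intro tendsto_intros)
  qed
qed

lemma nodal_grad_vertex: "nodal_grad (i, j) (v k) = (if i = k then g j else 0)"
  by (auto simp: nodal_grad_def bary_vertex simp flip: scaleR_left_distrib)

lemma nodal_grad_polys: "(\<lambda>x. nodal_grad p x \<bullet> w) \<in> polys 2"
proof -
  obtain i j where p: "p = (i, j)" by (cases p)
  have "(\<lambda>x. (1/2 * (g j \<bullet> w)) * L x i + (1/2 * (g j \<bullet> w)) * (L x i * L x i) + (- (g j \<bullet> w)) * (L x i * L x j)
      + (1/2 * (g i \<bullet> w)) * L x j + (g i \<bullet> w) * (L x i * L x j) + (-1/2 * (g i \<bullet> w)) * (L x j * L x j)) \<in> polys 2"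
    using polys_mono[OF _ bary_polys, of 2]
    by (intro polys_add polys_scale bary_product_polys) auto
  moreover have "(\<lambda>x. nodal_grad p x \<bullet> w) = (\<lambda>x. (1/2 * (g j \<bullet> w)) * L x i + (1/2 * (g j \<bullet> w)) * (L x i * L x i) + (- (g j \<bullet> w)) * (L x i * L x j)
      + (1/2 * (g i \<bullet> w)) * L x j + (g i \<bullet> w) * (L x i * L x j) + (-1/2 * (g i \<bullet> w)) * (L x j * L x j))"
    by (simp add: p nodal_grad_def fun_eq_iff inner_add_left algebra_simps)
  ultimately show ?thesis by simp
qed

end

section \<open>The enriched space and its correction\<close>

context tetra
begin

definition enriched where
  "enriched \<beta> c = (\<Sum>p\<in>UNIV. \<beta> p *\<^sub>R nodal p) + (\<Sum>t\<in>bubble_indices. c t *\<^sub>R bubble t)"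

definition enriched_grad where
  "enriched_grad \<beta> c x = (\<Sum>p\<in>UNIV. \<beta> p *\<^sub>R nodal_grad p x) + (\<Sum>t\<in>bubble_indices. c t *\<^sub>R bubble_grad t x)"

text \<open>For \<open>t = (i, l, m, n)\<close> this is the coefficient of \<open>\<lambda>\<^sub>l\<lambda>\<^sub>m\<close> in the normal trace on the face \<open>f\<^sub>i\<close>: both
bubbles of the edge contribute.\<close>

definition edge_coeff where
  "edge_coeff c t = c (opposite t) * dcoef v (fst t) (fst t) + c t * dcoef v (fst (opposite t)) (fst t)"

definition edge_sum where
  "edge_sum \<gamma> k x = (\<Sum>t\<in>bubble_indices. if fst t = k then \<gamma> t * edge_product t x else 0)"

definition poly_trace where
  "poly_trace \<beta> c k x = (\<Sum>p\<in>UNIV. \<beta> p * (nodal_grad p x \<bullet> outer_normal v k)) + edge_sum (edge_coeff c) k x"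

lemma enriched_jet: "jet (enriched \<beta> c) (\<lambda>i. \<beta> (i, i) / 2) (enriched_grad \<beta> c)"
proof -
  have "jet (enriched \<beta> c) (\<lambda>i. (\<Sum>p\<in>UNIV. \<beta> p * (if p = (i, i) then 1/2 else 0)) + (\<Sum>t\<in>bubble_indices. c t * 0))
    (\<lambda>x. (\<Sum>p\<in>UNIV. \<beta> p *\<^sub>R nodal_grad p x) + (\<Sum>t\<in>bubble_indices. c t *\<^sub>R bubble_grad t x))"
    unfolding enriched_def
    by (intro jet_add jet_sum jet_scale nodal_jet bubble_jet finite_bubble_indices finite)
  then show ?thesis by (simp add: enriched_grad_def[abs_def] sum_delta_pair)
qed

lemma edge_sum_polys: "edge_sum \<gamma> k \<in> polys 2"
proof -
  have "(\<lambda>x. if fst t = k then \<gamma> t * edge_product t x else 0) \<in> polys 2" for t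
    by (cases "fst t = k") (auto simp: edge_product_def polys_const split: prod.splits
        intro!: polys_scale bary_product_polys)
  then show ?thesis unfolding edge_sum_def[abs_def] by (intro polys_sum)
qed

lemma poly_trace_polys: "poly_trace \<beta> c k \<in> polys 2"
  unfolding poly_trace_def[abs_def]
  by (intro polys_add polys_sum polys_scale nodal_grad_polys edge_sum_polys)

text \<open>On the face \<open>k\<close>, the bubbles with \<open>n = k\<close> contribute as well as those with \<open>i = k\<close>.  Exchanging
opposite bubbles in the sum collects both under the latter.\<close>

lemma bubble_sum_trace:
  assumes x: "x \<in> face v k"
  shows "(\<Sum>t\<in>bubble_indices. c t * (bubble_grad t x \<bullet> outer_normal v k)) = edge_sum (edge_coeff c) k x + edge_part c k (L x)"
proof -
  have ep: "edge_product (opposite t) x = edge_product t x" for t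
    by (simp add: edge_product_def opposite_def split: prod.splits)
  have swap: "(\<Sum>t\<in>bubble_indices. if fst (opposite t) = k then c t * (dcoef v k k * edge_product t x) else 0)
    = (\<Sum>t\<in>bubble_indices. if fst t = k then c (opposite t) * (dcoef v k k * edge_product t x) else 0)"
    by (rule sum.reindex_bij_witness[of _ opposite opposite]) (auto simp: opposite_opposite opposite_bubble_indices ep)
  have "(\<Sum>t\<in>bubble_indices. c t * (bubble_grad t x \<bullet> outer_normal v k))
    = (\<Sum>t\<in>bubble_indices. (if fst (opposite t) = k then c t * (dcoef v k k * edge_product t x) else 0)
      + ((if fst t = k then c t * (dcoef v (fst (opposite t)) k * edge_product t x) else 0)
      + (if fst t = k then c t else 0) * bubble_edge_part t (L x)))"
    by (rule sum.cong) (auto simp: bubble_trace[OF _ x] algebra_simps)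
  also have "\<dots> = (\<Sum>t\<in>bubble_indices. if fst t = k then c (opposite t) * (dcoef v k k * edge_product t x) else 0)
    + (\<Sum>t\<in>bubble_indices. if fst t = k then c t * (dcoef v (fst (opposite t)) k * edge_product t x) else 0) + edge_part c k (L x)"
    by (simp only: sum.distrib swap) (simp add: edge_part_def sum_fun_apply scaleR_fun_def)
  also have "\<dots> = edge_sum (edge_coeff c) k x + edge_part c k (L x)"
    unfolding edge_sum_def edge_coeff_def by (simp add: sum.distrib[symmetric] algebra_simps cong: if_cong) 
      (auto intro!: sum.cong simp: algebra_simps)
  finally show ?thesis .
qed

lemma enriched_trace:
  assumes x: "x \<in> face v k"
  shows "enriched_grad \<beta> c x \<bullet> outer_normal v k = poly_trace \<beta> c k x + edge_part c k (L x)"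
  using bubble_sum_trace[OF x, of c]
  by (simp add: enriched_grad_def poly_trace_def inner_add_left inner_sum_left)

lemma normal_trace_enriched:
  "normal_trace v k (enriched \<beta> c) = on_set (face v k) (poly_trace \<beta> c k) + on_set (face v k) (\<lambda>x. edge_part c k (L x))"
  unfolding normal_trace_jet[OF enriched_jet] on_set_add by (rule on_set_cong) (rule enriched_trace)

text \<open>The image of an enriched function under \<open>R_T\<close>, with the lifts written in terms of the coefficients.\<close>

definition corrected where "corrected \<beta> c = enriched \<beta> c - (\<Sum>k\<in>UNIV. lift k (edge_part c k))"

lemma R_T_enriched: "R_T v (enriched \<beta> c) = corrected \<beta> c"
  unfolding R_T_def corrected_def
  by (simp add: q_part_eq[OF edge_part_in poly_trace_polys normal_trace_enriched] normal_lift_eq[OF edge_part_in])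

definition corrected_grad where
  "corrected_grad \<beta> c x = enriched_grad \<beta> c x
     - (\<Sum>k\<in>UNIV. if L x k = 0 then (edge_part c k (L x) / dcoef v k k) *\<^sub>R g k else 0)"

lemma corrected_jet: "jet (corrected \<beta> c) (\<lambda>i. \<beta> (i, i) / 2) (corrected_grad \<beta> c)"
proof -
  have "jet (enriched \<beta> c + (-1) *\<^sub>R (\<Sum>k\<in>UNIV. lift k (edge_part c k))) (\<lambda>i. \<beta> (i, i) / 2 + (-1) * (\<Sum>k\<in>(UNIV::4 set). 0))
    (\<lambda>x. enriched_grad \<beta> c x + (-1) *\<^sub>R (\<Sum>k\<in>UNIV. if L x k = 0 then (edge_part c k (L x) / dcoef v k k) *\<^sub>R g k else 0))"
    by (intro jet_add enriched_jet jet_scale jet_sum lift_jet edge_part_in finite)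
  moreover have "enriched \<beta> c + (-1) *\<^sub>R (\<Sum>k\<in>UNIV. lift k (edge_part c k)) = corrected \<beta> c"
    by (simp only: corrected_def scaleR_minus1_left diff_conv_add_uminus)
  ultimately show ?thesis by (simp add: corrected_grad_def[abs_def])
qed

text \<open>The lift from another face contributes nothing, since its form vanishes where a second coordinate
does; the lift from the face itself cancels the non-polynomial part.\<close>

lemma corrected_trace:
  assumes x: "x \<in> face v k"
  shows "corrected_grad \<beta> c x \<bullet> outer_normal v k = poly_trace \<beta> c k x"
proof -
  have k0: "L x k = 0" using x by (simp add: face_def)
  have "(\<Sum>i\<in>UNIV. if L x i = 0 then (edge_part c i (L x) / dcoef v i i) *\<^sub>R g i else 0)
    = (\<Sum>i\<in>UNIV. if i = k then (edge_part c i (L x) / dcoef v i i) *\<^sub>R g i else 0)"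
    by (rule sum.cong) (use k0 form_vanishes[OF edge_part_in _, of "L x" k] in auto)
  also have "\<dots> = (edge_part c k (L x) / dcoef v k k) *\<^sub>R g k" by simp
  finally show ?thesis
    using dcoef_diag_nonzero[of k]
    by (simp add: corrected_grad_def inner_diff_left enriched_trace[OF x] flip: dcoef_normal)
qed

lemma normal_trace_corrected: "normal_trace v k (corrected \<beta> c) = on_set (face v k) (poly_trace \<beta> c k)"
  unfolding normal_trace_jet[OF corrected_jet] by (rule on_set_cong) (rule corrected_trace)

lemma corrected_grad_vertex: "corrected_grad \<beta> c (v i) = (\<Sum>j\<in>UNIV. \<beta> (i, j) *\<^sub>R g j)"
proof -
  have Q0: "edge_part c k (L (v i)) = 0" for k
  proof -
    obtain j where "j \<noteq> i" "j \<noteq> k" using ex_index_outside_pair by blast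
    then show ?thesis by (intro form_vanishes[OF edge_part_in]) (auto simp: bary_vertex)
  qed
  have B0: "bubble_grad t (v i) = 0" if tI: "t \<in> bubble_indices" for t
  proof -
    obtain k l m n where t: "t = (k, l, m, n)" and d: "distinct [k, l, m, n]" using tI by (rule bubble_indices_cases)
    show ?thesis using d
      by (auto simp: t bubble_grad_def Phi_l_def Phi_m_def Phi_n_def bary_vertex)
  qed
  have "(\<Sum>p\<in>UNIV. \<beta> p *\<^sub>R nodal_grad p (v i)) = (\<Sum>k\<in>UNIV. if k = i then \<Sum>j\<in>UNIV. \<beta> (k, j) *\<^sub>R g j else 0)"
    unfolding sum_pairs by (rule sum.cong) (auto simp: nodal_grad_vertex)
  then show ?thesis by (simp add: corrected_grad_def enriched_grad_def Q0 B0 cong: if_cong)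
qed

lemma hermite_dofs_corrected: "hermite_dofs v (corrected \<beta> c) = (\<chi> i. (\<beta> (i, i) / 2, \<Sum>j\<in>UNIV. \<beta> (i, j) *\<^sub>R g j))"
  by (simp add: hermite_dofs_jet[OF corrected_jet] corrected_grad_vertex)

lemma enriched_add: "enriched (\<lambda>p. \<beta> p + \<beta>' p) (\<lambda>t. c t + c' t) = enriched \<beta> c + enriched \<beta>' c'"
  by (simp only: enriched_def scaleR_left_distrib sum.distrib add_ac)

lemma enriched_scale: "enriched (\<lambda>p. a * \<beta> p) (\<lambda>t. a * c t) = a *\<^sub>R enriched \<beta> c"
  by (simp only: enriched_def scaleR_scaleR[symmetric] scaleR_right.sum[symmetric] scaleR_right_distrib)

definition enriched_space where "enriched_space = range (\<lambda>(\<beta>, c). enriched \<beta> c)"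

lemma enriched_spaceI: "enriched \<beta> c \<in> enriched_space"
  unfolding enriched_space_def by (rule range_eqI[of _ _ "(\<beta>, c)"]) simp

lemma enriched_spaceE:
  assumes "z \<in> enriched_space"
  obtains \<beta> c where "z = enriched \<beta> c"
  using assms unfolding enriched_space_def by auto

lemma subspace_enriched: "subspace enriched_space"
proof (rule subspaceI)
  have "enriched (\<lambda>p. 0) (\<lambda>t. 0) = 0" by (simp only: enriched_def scaleR_zero_left sum.neutral_const add_0)
  then show "0 \<in> enriched_space" by (rule subst[where P = "\<lambda>z. z \<in> enriched_space"]) (rule enriched_spaceI)
next
  fix x y assume "x \<in> enriched_space" "y \<in> enriched_space"
  then obtain \<beta> c \<beta>' c' where "x = enriched \<beta> c" "y = enriched \<beta>' c'" by (metis enriched_spaceE)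
  then show "x + y \<in> enriched_space" by (simp only: enriched_add[symmetric] enriched_spaceI)
next
  fix a x assume "x \<in> enriched_space"
  then obtain \<beta> c where "x = enriched \<beta> c" by (rule enriched_spaceE)
  then show "a *\<^sub>R x \<in> enriched_space" by (simp only: enriched_scale[symmetric] enriched_spaceI)
qed

lemma nodal_in_enriched: "nodal q \<in> enriched_space"
proof -
  have "enriched (\<lambda>p. if p = q then 1 else 0) (\<lambda>t. 0) = (\<Sum>p\<in>UNIV. if p = q then nodal p else 0) + 0"
    unfolding enriched_def by (intro arg_cong2[of _ _ _ _ "(+)"] sum.cong) (simp_all only: scaleR_zero_left scaleR_one sum.neutral_const split: if_split, auto)
  also have "\<dots> = nodal q" by (simp only: sum.delta[OF finite] UNIV_I if_True add_0_right)
  finally show ?thesis by (rule subst[where P = "\<lambda>z. z \<in> enriched_space"]) (rule enriched_spaceI)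
qed

lemma bubble_in_enriched: "q \<in> bubble_indices \<Longrightarrow> bubble q \<in> enriched_space"
proof -
  assume q: "q \<in> bubble_indices"
  have "enriched (\<lambda>p. 0) (\<lambda>t. if t = q then 1 else 0) = 0 + (\<Sum>t\<in>bubble_indices. if t = q then bubble t else 0)"
    unfolding enriched_def by (intro arg_cong2[of _ _ _ _ "(+)"] sum.cong) (simp_all only: scaleR_zero_left scaleR_one sum.neutral_const split: if_split, auto)
  also have "\<dots> = bubble q" using q by (simp only: sum.delta[OF finite_bubble_indices] if_True add_0_left)
  finally show ?thesis by (rule subst[where P = "\<lambda>z. z \<in> enriched_space"]) (rule enriched_spaceI)
qed

lemma edge_bubble_index:
  assumes "l < m" "n \<notin> {l, m}"
  obtains i where "(i, l, m, n) \<in> bubble_indices" "edge_bubble v l m n = bubble (i, l, m, n)"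
proof -
  have "distinct [l, m, n]" using assms by auto
  then obtain i where "{l, m, n, i} = UNIV" by (rule complete_indices)
  then have "{i, l, m, n} = UNIV" by auto
  then show thesis using assms by (intro that[of i]) (auto simp: bubble_indices_def bubble_def)
qed

lemma bary_product_nodal: "on_set I (\<lambda>x. L x i * L x j) = nodal (i, j) + nodal (j, i)"
  unfolding nodal_def prod.case on_set_add by (rule on_set_cong) (simp add: algebra_simps)

lemma polys_on_in_enriched:
  assumes "z \<in> polys_on I 2"
  shows "z \<in> enriched_space"
proof -
  obtain p where p: "p \<in> polys 2" "z = on_set I p" using assms by (auto simp: polys_on_def)
  obtain A where A: "\<And>x. p x = (\<Sum>i\<in>UNIV. \<Sum>j\<in>UNIV. A i j * (L x i * L x j))"
    using quadratic_form_polys[OF p(1)] unfolding quadratic_form_def by blast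
  have "z = (\<Sum>i\<in>UNIV. \<Sum>j\<in>UNIV. A i j *\<^sub>R (nodal (i, j) + nodal (j, i)))"
    unfolding p(2) bary_product_nodal[symmetric] on_set_scale on_set_sum
    by (rule on_set_cong) (simp add: A)
  also have "\<dots> \<in> enriched_space"
    by (intro subspace_sum[OF subspace_enriched] subspace_scale[OF subspace_enriched] subspace_add[OF subspace_enriched] nodal_in_enriched)
  finally show ?thesis .
qed

lemma subspace_Z3_0: "subspace (Z3_0 v)"
proof -
  have "Z3_0 v = {p + w | p w. p \<in> polys_on I 2 \<and>
     w \<in> span {on_set I (\<lambda>x. (L x i)\<^sup>2 * L x j - (L x j)\<^sup>2 * L x i) | i j. i < j}}"
    unfolding Z3_0_def ..
  then show ?thesis using subspace_sums[OF subspace_polys_on[of I 2] subspace_span] by simp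
qed

lemma nodal_in_Z3_0: "nodal (i, j) \<in> Z3_0 v"
proof -
  let ?S = "{on_set I (\<lambda>x. (L x i)\<^sup>2 * L x j - (L x j)\<^sup>2 * L x i) | i j. i < j}"
  define w where "w i j = on_set I (\<lambda>x. (L x i)\<^sup>2 * L x j - (L x j)\<^sup>2 * L x i)" for i j
  have w: "w i j \<in> span ?S"
  proof (cases i j rule: linorder_cases)
    case less
    then show ?thesis by (intro span_base) (auto simp: w_def)
  next
    case equal
    have w0: "w i j = 0" unfolding w_def equal by (simp add: on_set_0)
    show ?thesis unfolding w0 by (rule span_zero)
  next
    case greater
    then have "w j i \<in> span ?S" by (intro span_base) (auto simp: w_def)
    moreover have "w i j = (- 1) *\<^sub>R w j i" unfolding w_def on_set_scale by (rule on_set_cong) simp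
    ultimately show ?thesis by (simp only: span_scale)
  qed
  have "nodal (i, j) = on_set I (\<lambda>x. (1/2) * (L x i * L x j)) + (1/2) *\<^sub>R w i j"
    unfolding nodal_def prod.case w_def on_set_scale on_set_add
    by (rule on_set_cong) (simp add: algebra_simps power2_eq_square)
  moreover have "on_set I (\<lambda>x. (1/2) * (L x i * L x j)) \<in> polys_on I 2"
    by (intro polys_onI polys_scale bary_product_polys)
  moreover have "(1/2) *\<^sub>R w i j \<in> span ?S" using w by (rule span_scale)
  ultimately show ?thesis unfolding Z3_0_def by blast
qed

text \<open>The generators are expressed by each other: \<open>\<lambda>\<^sub>i\<lambda>\<^sub>j = N\<^sub>i\<^sub>j + N\<^sub>j\<^sub>i\<close> and
\<open>\<lambda>\<^sub>i\<^sup>2\<lambda>\<^sub>j - \<lambda>\<^sub>j\<^sup>2\<lambda>\<^sub>i = N\<^sub>i\<^sub>j - N\<^sub>j\<^sub>i\<close>.\<close>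

lemma Z3_e_eq: "Z3_e v = enriched_space"
proof (intro subset_antisym subsetI)
  fix z assume "z \<in> Z3_e v"
  then obtain p w u where z: "z = (p + w) + u" and p: "p \<in> polys_on I 2"
    and w: "w \<in> span {on_set I (\<lambda>x. (L x i)\<^sup>2 * L x j - (L x j)\<^sup>2 * L x i) | i j. i < j}"
    and u: "u \<in> span {edge_bubble v l m n | l m n. l < m \<and> n \<notin> {l, m}}"
    unfolding Z3_e_def Z3_0_def by blast
  have "on_set I (\<lambda>x. (L x i)\<^sup>2 * L x j - (L x j)\<^sup>2 * L x i) \<in> enriched_space" for i j
  proof -
    have "on_set I (\<lambda>x. (L x i)\<^sup>2 * L x j - (L x j)\<^sup>2 * L x i) = nodal (i, j) - nodal (j, i)"
      unfolding nodal_def prod.case on_set_diff by (rule on_set_cong) (simp add: algebra_simps power2_eq_square)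
    then show ?thesis using subspace_diff[OF subspace_enriched nodal_in_enriched nodal_in_enriched] by simp
  qed
  then have "{on_set I (\<lambda>x. (L x i)\<^sup>2 * L x j - (L x j)\<^sup>2 * L x i) | i j. i < j} \<subseteq> enriched_space" by blast
  then have "w \<in> enriched_space" using subsetD[OF span_minimal[OF _ subspace_enriched] w] by blast
  have sub: "{edge_bubble v l m n | l m n. l < m \<and> n \<notin> {l, m}} \<subseteq> enriched_space"
  proof (rule subsetI, elim CollectE exE conjE)
    fix e l m n assume e: "e = edge_bubble v l m n" and lm: "l < m" "n \<notin> {l, m}"
    obtain i where "(i, l, m, n) \<in> bubble_indices" "edge_bubble v l m n = bubble (i, l, m, n)"
      using lm by (rule edge_bubble_index)
    then show "e \<in> enriched_space" unfolding e using bubble_in_enriched by simp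
  qed
  have "u \<in> enriched_space" using subsetD[OF span_minimal[OF sub subspace_enriched] u] .
  then show "z \<in> enriched_space" unfolding z
    using polys_on_in_enriched[OF p] \<open>w \<in> enriched_space\<close> by (intro subspace_add[OF subspace_enriched])
next
  fix z assume "z \<in> enriched_space"
  then obtain \<beta> c where z: "z = enriched \<beta> c" by (rule enriched_spaceE)
  have "(\<Sum>p\<in>UNIV. \<beta> p *\<^sub>R nodal p) \<in> Z3_0 v"
    by (intro subspace_sum[OF subspace_Z3_0] subspace_scale[OF subspace_Z3_0]) (simp add: nodal_in_Z3_0 split_paired_all)
  moreover have "(\<Sum>t\<in>bubble_indices. c t *\<^sub>R bubble t) \<in> span {edge_bubble v l m n | l m n. l < m \<and> n \<notin> {l, m}}"
  proof (intro span_sum span_scale span_base)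
    fix t assume t: "t \<in> bubble_indices"
    then obtain i l m n where t': "t = (i, l, m, n)" "l < m" "{i, l, m, n} = UNIV" by (auto simp: bubble_indices_def)
    then have "n \<notin> {l, m}" using four_indices_distinct[OF t'(3)] by auto
    then show "bubble t \<in> {edge_bubble v l m n | l m n. l < m \<and> n \<notin> {l, m}}"
      using t' unfolding bubble_def by auto
  qed
  ultimately show "z \<in> Z3_e v" unfolding z enriched_def Z3_e_def by blast
qed

lemma Z3_red_eq: "Z3_red v = {corrected \<beta> c |\<beta> c. \<forall>k. on_set (face v k) (poly_trace \<beta> c k) \<in> polys_on (face v k) 1}"
proof (intro subset_antisym subsetI)
  fix z assume "z \<in> Z3_red v"
  then obtain y where y: "y \<in> enriched_space" "z = R_T v y" and tr: "\<And>k. normal_trace v k z \<in> polys_on (face v k) 1"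
    unfolding Z3_red_def Z3_sing_def Z3_e_eq by blast
  obtain \<beta> c where "y = enriched \<beta> c" using y(1) by (rule enriched_spaceE)
  then have "z = corrected \<beta> c" using y(2) by (simp only: R_T_enriched)
  then show "z \<in> {corrected \<beta> c |\<beta> c. \<forall>k. on_set (face v k) (poly_trace \<beta> c k) \<in> polys_on (face v k) 1}"
    using tr unfolding normal_trace_corrected[symmetric] by blast
next
  fix z assume "z \<in> {corrected \<beta> c |\<beta> c. \<forall>k. on_set (face v k) (poly_trace \<beta> c k) \<in> polys_on (face v k) 1}"
  then obtain \<beta> c where z: "z = corrected \<beta> c" "\<forall>k. normal_trace v k z \<in> polys_on (face v k) 1"
    unfolding normal_trace_corrected[symmetric] by blast
  have "z \<in> R_T v ` enriched_space" unfolding z(1) R_T_enriched[symmetric] by (rule imageI enriched_spaceI)+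
  then show "z \<in> Z3_red v" using z(2) unfolding Z3_red_def Z3_sing_def Z3_e_eq by blast
qed

end

section \<open>Unisolvence\<close>

context tetra
begin

text \<open>On the face, \<open>p\<close> becomes affine after adding a combination of the three edge products.\<close>

definition reducible where
  "reducible k p \<longleftrightarrow> (\<exists>\<gamma>. on_set (face v k) (\<lambda>x. p x + edge_sum \<gamma> k x) \<in> polys_on (face v k) 1)"

lemma edge_sum_lincomb: "edge_sum (\<lambda>t. a * \<gamma> t + \<gamma>' t) k x = a * edge_sum \<gamma> k x + edge_sum \<gamma>' k x"
  unfolding edge_sum_def sum_distrib_left sum.distrib[symmetric]
  by (rule sum.cong) (auto simp: algebra_simps)

lemma reducible_lincomb:
  assumes "reducible k p" "reducible k q"
  shows "reducible k (\<lambda>x. a * p x + q x)"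
proof -
  obtain \<gamma> \<gamma>' where 1: "on_set (face v k) (\<lambda>x. p x + edge_sum \<gamma> k x) \<in> polys_on (face v k) 1"
    and 2: "on_set (face v k) (\<lambda>x. q x + edge_sum \<gamma>' k x) \<in> polys_on (face v k) 1"
    using assms unfolding reducible_def by blast
  have "on_set (face v k) (\<lambda>x. a * p x + q x + edge_sum (\<lambda>t. a * \<gamma> t + \<gamma>' t) k x)
    = a *\<^sub>R on_set (face v k) (\<lambda>x. p x + edge_sum \<gamma> k x) + on_set (face v k) (\<lambda>x. q x + edge_sum \<gamma>' k x)"
    unfolding on_set_scale on_set_add edge_sum_lincomb by (rule on_set_cong) (simp add: algebra_simps)
  moreover have "\<dots> \<in> polys_on (face v k) 1"
    by (intro subspace_add[OF subspace_polys_on] subspace_scale[OF subspace_polys_on] 1 2)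
  ultimately show ?thesis unfolding reducible_def by (intro exI[of _ "\<lambda>t. a * \<gamma> t + \<gamma>' t"]) (simp only:)
qed

lemma reducible_polys1:
  assumes "p \<in> polys 1"
  shows "reducible k p"
  unfolding reducible_def
  by (rule exI[of _ "\<lambda>t. 0"]) (use assms in \<open>simp add: edge_sum_def polys_onI cong: if_cong\<close>)

lemma reducible_cong:
  assumes "reducible k p" "\<And>x. x \<in> face v k \<Longrightarrow> p x = q x"
  shows "reducible k q"
proof -
  have "on_set (face v k) (\<lambda>x. p x + edge_sum \<gamma> k x) = on_set (face v k) (\<lambda>x. q x + edge_sum \<gamma> k x)" for \<gamma>
    by (rule on_set_cong) (simp add: assms(2))
  then show ?thesis using assms(1) unfolding reducible_def by simp
qed

lemma reducible_zero: "reducible k (\<lambda>x. 0)"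
  by (rule reducible_polys1[OF polys_const])

lemma reducible_sum:
  assumes "finite A" "\<And>t. t \<in> A \<Longrightarrow> reducible k (p t)"
  shows "reducible k (\<lambda>x. \<Sum>t\<in>A. a t * p t x)"
  using assms
proof (induction A rule: finite_induct)
  case empty
  then show ?case by (simp add: reducible_zero)
next
  case (insert t A)
  then show ?case using reducible_lincomb[of k "p t" "\<lambda>x. \<Sum>t\<in>A. a t * p t x" "a t"] by simp
qed

lemma reducible_mixed_product:
  assumes "i \<noteq> j"
  shows "reducible k (\<lambda>x. L x i * L x j)"
proof (cases "i = k \<or> j = k")
  case True
  then show ?thesis
    by (intro reducible_cong[OF reducible_zero[of k]]) (auto simp: face_def)
next
  case False
  \<comment> \<open>Bubble indices list the end points of an edge in increasing order.\<close>
  define l m where "l = min i j" and "m = max i j"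
  have lm: "l < m" "distinct [k, l, m]" using False assms by (auto simp: l_def m_def min_def max_def)
  then obtain n where U: "{k, l, m, n} = UNIV" by (metis complete_indices)
  let ?t = "(k, l, m, n)"
  have "?t \<in> bubble_indices" using lm U by (simp add: bubble_indices_def)
  have "edge_sum (\<lambda>t. if t = ?t then -1 else 0) k x = - (L x i * L x j)" for x
  proof -
    have "edge_sum (\<lambda>t. if t = ?t then -1 else 0) k x = (\<Sum>t\<in>bubble_indices. if t = ?t then - edge_product t x else 0)"
      unfolding edge_sum_def by (rule sum.cong) auto
    also have "\<dots> = - edge_product ?t x" using \<open>?t \<in> bubble_indices\<close> finite_bubble_indices by simp
    finally show ?thesis by (simp add: edge_product_def l_def m_def min_def max_def)
  qed
  then have z0: "on_set (face v k) (\<lambda>x. L x i * L x j + edge_sum (\<lambda>t. if t = ?t then -1 else 0) k x) = 0"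
    by (simp add: on_set_0)
  show ?thesis
    unfolding reducible_def
    by (rule exI[of _ "\<lambda>t. if t = ?t then -1 else 0"]) (unfold z0, rule subspace_0[OF subspace_polys_on])
qed

text \<open>For \<open>i = j\<close> the identity \<open>\<lambda>\<^sub>i\<^sup>2 = \<lambda>\<^sub>i - \<Sum>\<^sub>j \<lambda>\<^sub>i\<lambda>\<^sub>j\<close>, with the sum over \<open>j \<noteq> i\<close>, reduces the claim to
mixed products.\<close>

lemma reducible_product: "reducible k (\<lambda>x. L x i * L x j)"
proof (cases "i = j")
  case False
  then show ?thesis by (rule reducible_mixed_product)
next
  case True
  have "reducible k (\<lambda>x. (-1) * (\<Sum>j\<in>UNIV - {i}. 1 * (L x i * L x j)) + L x i)"
    by (intro reducible_lincomb reducible_polys1 bary_polys reducible_sum reducible_mixed_product) auto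
  moreover have "(-1) * (\<Sum>j\<in>UNIV - {i}. 1 * (L x i * L x j)) + L x i = L x i * L x j" for x
  proof -
    have "L x i + (\<Sum>j\<in>UNIV - {i}. L x j) = 1"
      using bary_props(1)[of x] sum.remove[OF finite UNIV_I, of "L x" i] by simp
    then have others: "(\<Sum>j\<in>UNIV - {i}. L x j) = 1 - L x i" by simp
    have "(\<Sum>j\<in>UNIV - {i}. 1 * (L x i * L x j)) = L x i * (1 - L x i)"
      by (simp only: mult_1_left sum_distrib_left[symmetric] others)
    then show ?thesis using True by (simp add: algebra_simps)
  qed
  ultimately show ?thesis by simp
qed

lemma reducible_polys2:
  assumes "p \<in> polys 2"
  shows "reducible k p"
proof -
  obtain A where A: "\<And>x. p x = (\<Sum>i\<in>UNIV. \<Sum>j\<in>UNIV. A i j * (L x i * L x j))"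
    using quadratic_form_polys[OF assms] unfolding quadratic_form_def by blast
  have "reducible k (\<lambda>x. \<Sum>i\<in>UNIV. 1 * (\<Sum>j\<in>UNIV. A i j * (L x i * L x j)))"
    by (intro reducible_sum reducible_product) auto
  then show ?thesis by (rule reducible_cong) (simp add: A)
qed

text \<open>An affine function has at the midpoint of an edge the mean of its values at the end points.  The edge
products all vanish at the vertices, and at the midpoint only the product of this edge survives.\<close>

lemma edge_sum_affine_imp_zero:
  assumes aff: "on_set (face v k) (edge_sum \<gamma> k) \<in> polys_on (face v k) 1"
    and t: "t \<in> bubble_indices" "fst t = k"
  shows "\<gamma> t = 0"
proof -
  obtain i l m n where t': "t = (i, l, m, n)" and lm: "l < m" and U: "{i, l, m, n} = UNIV" and d: "distinct [i, l, m, n]"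
    using t(1) by (rule bubble_indices_cases)
  have ne: "l \<noteq> k" "m \<noteq> k" "l \<noteq> m" using d t(2) t' by auto
  obtain p where p: "p \<in> polys 1" "on_set (face v k) (edge_sum \<gamma> k) = on_set (face v k) p"
    using aff by (auto simp: polys_on_def)
  have eq: "edge_sum \<gamma> k x = p x" if "x \<in> face v k" for x by (rule on_set_eqD[OF p(2) that])
  have vert: "edge_sum \<gamma> k (v j) = 0" for j
    unfolding edge_sum_def
    by (rule sum.neutral) (auto elim!: bubble_indices_cases simp: edge_product_def bary_vertex split: if_splits)
  have "edge_sum \<gamma> k (edge_midpt l m) = (\<Sum>s\<in>bubble_indices. if s = t then \<gamma> t / 4 else 0)"
    unfolding edge_sum_def
  proof (rule sum.cong)
    fix s assume "s \<in> bubble_indices"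
    then obtain i' l' m' n' where s: "s = (i', l', m', n')" and lm': "l' < m'" and U': "{i', l', m', n'} = UNIV"
      and d': "distinct [i', l', m', n']" by (rule bubble_indices_cases)
    show "(if fst s = k then \<gamma> s * edge_product s (edge_midpt l m) else 0) = (if s = t then \<gamma> t / 4 else 0)"
    proof (cases "fst s = k \<and> l' \<in> {l, m} \<and> m' \<in> {l, m}")
      case True
      then have 1: "l' = l" "m' = m" "i' = i" using lm lm' t(2) t' s by auto
      have "n' \<in> {i, l, m, n}" using U by simp
      then have "n' = n" using d' 1 by auto
      then have "s = t" using 1 s t' by simp
      then show ?thesis using t(2) ne by (simp add: t' edge_product_def bary_edge_midpt)
    next
      case False
      then have "s \<noteq> t" using s t' t(2) by auto
      then show ?thesis using False by (auto simp: s edge_product_def bary_edge_midpt)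
    qed
  qed simp
  also have "\<dots> = \<gamma> t / 4" using t(1) finite_bubble_indices by simp
  finally have "\<gamma> t / 4 = p (edge_midpt l m)" using eq[OF edge_midpt_face[OF ne(1,2)]] by simp
  also have "\<dots> = 0"
    using affine_edge_midpt[OF p(1), of l m] eq[OF vertex_face[OF ne(1)]] eq[OF vertex_face[OF ne(2)]] by (simp add: vert)
  finally show ?thesis by simp
qed

text \<open>Cramer's rule for the two opposite bubbles of each edge; the determinant is symmetric in the two.\<close>

lemma edge_coeff_surj:
  "\<exists>c. \<forall>t\<in>bubble_indices. edge_coeff c t = \<gamma> t"
proof -
  define \<Delta> where "\<Delta> i n = dcoef v n i * dcoef v i n - dcoef v i i * dcoef v n n" for i n
  define c where "c t = (\<gamma> t * dcoef v (fst t) (fst (opposite t)) - \<gamma> (opposite t) * dcoef v (fst t) (fst t))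
     / \<Delta> (fst t) (fst (opposite t))" for t
  have "edge_coeff c t = \<gamma> t" if tI: "t \<in> bubble_indices" for t
  proof -
    obtain i l m n where t: "t = (i, l, m, n)" and d: "distinct [i, l, m, n]" using tI by (rule bubble_indices_cases)
    have "\<Delta> i n \<noteq> 0" using dcoef_det_nonzero[of i n] d by (simp add: \<Delta>_def)
    moreover have "\<Delta> n i = \<Delta> i n" by (simp add: \<Delta>_def mult.commute)
    ultimately have "edge_coeff c t * \<Delta> i n = (\<gamma> (n, l, m, i) * dcoef v n i - \<gamma> t * dcoef v n n) * dcoef v i i
      + (\<gamma> t * dcoef v i n - \<gamma> (n, l, m, i) * dcoef v i i) * dcoef v n i"
      by (simp add: edge_coeff_def c_def t opposite_def add_divide_distrib[symmetric])
    also have "\<dots> = \<gamma> t * \<Delta> i n" by (simp add: \<Delta>_def algebra_simps)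
    finally show ?thesis using \<open>\<Delta> i n \<noteq> 0\<close> by simp
  qed
  then show ?thesis by blast
qed

lemma edge_coeff_inj:
  assumes "\<And>t. t \<in> bubble_indices \<Longrightarrow> edge_coeff c t = 0" "t \<in> bubble_indices"
  shows "c t = 0"
proof -
  obtain i l m n where t: "t = (i, l, m, n)" and d: "distinct [i, l, m, n]" using assms(2) by (rule bubble_indices_cases)
  have 1: "c (n, l, m, i) * dcoef v i i + c t * dcoef v n i = 0"
    using assms(1)[OF assms(2)] by (simp add: edge_coeff_def t opposite_def)
  have 2: "c t * dcoef v n n + c (n, l, m, i) * dcoef v i n = 0"
    using assms(1)[OF opposite_bubble_indices[OF assms(2)]] by (simp add: edge_coeff_def t opposite_def)
  have "c t * (dcoef v n i * dcoef v i n - dcoef v i i * dcoef v n n)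
    = (c (n, l, m, i) * dcoef v i i + c t * dcoef v n i) * dcoef v i n
      - (c t * dcoef v n n + c (n, l, m, i) * dcoef v i n) * dcoef v i i"
    by (simp add: algebra_simps)
  then have "c t * (dcoef v n i * dcoef v i n - dcoef v i i * dcoef v n n) = 0" by (simp add: 1 2)
  then show ?thesis using dcoef_det_nonzero[of i n] d by simp
qed

text \<open>Tested against an edge \<open>v\<^sub>m - v\<^sub>i\<close>, the sum picks the coefficients \<open>m\<close> and \<open>i\<close>, and their difference
is \<open>h \<bullet> (v\<^sub>m - v\<^sub>i)\<close>.  The constant \<open>s\<close> is free, which later allows the vertex value to be prescribed.\<close>

lemma gradient_expansion: "(\<Sum>j\<in>UNIV. (h \<bullet> (v j - v i) + s) *\<^sub>R g j) = h"
proof -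
  have "(\<Sum>j\<in>UNIV. (h \<bullet> (v j - v i) + s) *\<^sub>R g j) - h = 0"
  proof (rule zero_if_orthogonal_to_edges[where k = i])
    fix m
    have "(\<Sum>j\<in>UNIV. (h \<bullet> (v j - v i) + s) *\<^sub>R g j) \<bullet> (v m - v i)
      = (\<Sum>j\<in>UNIV. (if j = m then h \<bullet> (v j - v i) + s else 0) - (if j = i then h \<bullet> (v j - v i) + s else 0))"
      by (simp add: inner_sum_left g_edge) (auto intro!: sum.cong)
    also have "\<dots> = h \<bullet> (v m - v i)" by (simp add: sum_subtractf)
    finally show "((\<Sum>j\<in>UNIV. (h \<bullet> (v j - v i) + s) *\<^sub>R g j) - h) \<bullet> (v m - v i) = 0"
      by (simp add: inner_diff_left[of _ h])
  qed
  then show ?thesis by simp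
qed

lemma gradient_coeff_unique:
  assumes "(\<Sum>j\<in>UNIV. b j *\<^sub>R g j) = (\<Sum>j\<in>UNIV. b' j *\<^sub>R g j)" "b i = b' i"
  shows "b = b'"
proof
  fix m
  have "(\<Sum>j\<in>UNIV. b j *\<^sub>R g j) \<bullet> (v m - v i) = b m - b i" for b
  proof -
    have "(\<Sum>j\<in>UNIV. b j *\<^sub>R g j) \<bullet> (v m - v i)
      = (\<Sum>j\<in>UNIV. (if j = m then b j else 0) - (if j = i then b j else 0))"
      by (simp add: inner_sum_left g_edge) (auto intro!: sum.cong)
    then show ?thesis by (simp add: sum_subtractf)
  qed
  from this[of b] this[of b'] show "b m = b' m" using assms by simp
qed

lemma edge_part_lincomb: "edge_part (\<lambda>t. a * c t + c' t) k = a *\<^sub>R edge_part c k + edge_part c' k"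
  unfolding edge_part_def scaleR_right.sum sum.distrib[symmetric]
  by (rule sum.cong) (auto simp: scaleR_left_distrib)

lemma lift_lincomb: "lift k (a *\<^sub>R F + F') = a *\<^sub>R lift k F + lift k F'"
  unfolding lift_def on_set_scale on_set_add
  by (rule on_set_cong) (simp add: scaleR_fun_def algebra_simps add_divide_distrib)

lemma enriched_lincomb: "enriched (\<lambda>p. a * \<beta> p + \<beta>' p) (\<lambda>t. a * c t + c' t) = a *\<^sub>R enriched \<beta> c + enriched \<beta>' c'"
  by (simp only: enriched_add enriched_scale)

lemma corrected_lincomb: "corrected (\<lambda>p. a * \<beta> p + \<beta>' p) (\<lambda>t. a * c t + c' t) = a *\<^sub>R corrected \<beta> c + corrected \<beta>' c'"
proof -
  have "corrected (\<lambda>p. a * \<beta> p + \<beta>' p) (\<lambda>t. a * c t + c' t)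
    = a *\<^sub>R enriched \<beta> c + enriched \<beta>' c' - (a *\<^sub>R (\<Sum>k\<in>UNIV. lift k (edge_part c k)) + (\<Sum>k\<in>UNIV. lift k (edge_part c' k)))"
    by (simp only: corrected_def enriched_lincomb edge_part_lincomb lift_lincomb sum.distrib scaleR_right.sum)
  then show ?thesis by (simp only: corrected_def scaleR_right_diff_distrib) (simp only: add_diff_add)
qed

lemma poly_trace_lincomb:
  "poly_trace (\<lambda>p. a * \<beta> p + \<beta>' p) (\<lambda>t. a * c t + c' t) k x = a * poly_trace \<beta> c k x + poly_trace \<beta>' c' k x"
proof -
  have ec: "edge_coeff (\<lambda>t. a * c t + c' t) = (\<lambda>t. a * edge_coeff c t + edge_coeff c' t)"
    by (simp add: edge_coeff_def fun_eq_iff algebra_simps)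
  show ?thesis
    unfolding poly_trace_def ec edge_sum_lincomb
    by (simp add: sum.distrib sum_distrib_left algebra_simps)
qed

lemma subspace_Z3_red: "subspace (Z3_red v)"
proof -
  have lin: "a *\<^sub>R y + z \<in> Z3_red v" if yz: "y \<in> Z3_red v" "z \<in> Z3_red v" for a y z
  proof -
    obtain \<beta> c \<beta>' c' where y: "y = corrected \<beta> c" "\<And>k. on_set (face v k) (poly_trace \<beta> c k) \<in> polys_on (face v k) 1"
      and z: "z = corrected \<beta>' c'" "\<And>k. on_set (face v k) (poly_trace \<beta>' c' k) \<in> polys_on (face v k) 1"
      using yz unfolding Z3_red_eq by blast
    have "on_set (face v k) (poly_trace (\<lambda>p. a * \<beta> p + \<beta>' p) (\<lambda>t. a * c t + c' t) k)
      = a *\<^sub>R on_set (face v k) (poly_trace \<beta> c k) + on_set (face v k) (poly_trace \<beta>' c' k)" for k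
      unfolding on_set_scale on_set_add by (rule on_set_cong) (rule poly_trace_lincomb)
    moreover have "a *\<^sub>R on_set (face v k) (poly_trace \<beta> c k) + on_set (face v k) (poly_trace \<beta>' c' k) \<in> polys_on (face v k) 1" for k
      by (intro subspace_add[OF subspace_polys_on] subspace_scale[OF subspace_polys_on] y z)
    ultimately have "\<forall>k. on_set (face v k) (poly_trace (\<lambda>p. a * \<beta> p + \<beta>' p) (\<lambda>t. a * c t + c' t) k) \<in> polys_on (face v k) 1"
      by (simp only:) blast
    then show ?thesis unfolding y(1) z(1) corrected_lincomb[symmetric] Z3_red_eq by blast
  qed
  have p0: "on_set (face v k) (poly_trace (\<lambda>p. 0) (\<lambda>t. 0) k) = 0" for k
  proof -
    have "on_set (face v k) (poly_trace (\<lambda>p. 0) (\<lambda>t. 0) k) = on_set (face v k) (\<lambda>x. 0)"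
      by (rule on_set_cong) (simp add: poly_trace_def edge_sum_def edge_coeff_def cong: if_cong)
    then show ?thesis unfolding on_set_0 .
  qed
  have "\<forall>k. on_set (face v k) (poly_trace (\<lambda>p. 0) (\<lambda>t. 0) k) \<in> polys_on (face v k) 1"
    unfolding p0 using subspace_0[OF subspace_polys_on] by blast
  then have "corrected (\<lambda>p. 0) (\<lambda>t. 0) \<in> Z3_red v" unfolding Z3_red_eq by blast
  then have zero: "0 \<in> Z3_red v"
    using lin[of "corrected (\<lambda>p. 0) (\<lambda>t. 0)" "corrected (\<lambda>p. 0) (\<lambda>t. 0)" "-1"] by (simp only: scaleR_minus1_left left_minus)
  show ?thesis
  proof (rule subspaceI[OF zero])
    show "x + y \<in> Z3_red v" if "x \<in> Z3_red v" "y \<in> Z3_red v" for x y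
      using lin[OF that, of 1] by (simp only: scaleR_one)
    show "a *\<^sub>R x \<in> Z3_red v" if "x \<in> Z3_red v" for a x
      using lin[OF that zero, of a] by (simp only: add_0_right)
  qed
qed

lemma Z3_red_jet:
  assumes "z \<in> Z3_red v"
  obtains a h where "jet z a h"
proof -
  obtain \<beta> c where z: "z = corrected \<beta> c" using assms unfolding Z3_red_eq by blast
  show thesis by (rule that) (unfold z, rule corrected_jet)
qed

lemma hermite_dofs_add:
  assumes "y \<in> Z3_red v" "z \<in> Z3_red v"
  shows "hermite_dofs v (y + z) = hermite_dofs v y + hermite_dofs v z"
proof -
  obtain a h where y: "jet y a h" using assms(1) by (rule Z3_red_jet)
  obtain b k where z: "jet z b k" using assms(2) by (rule Z3_red_jet)
  show ?thesis
    by (simp only: hermite_dofs_jet[OF y] hermite_dofs_jet[OF z] hermite_dofs_jet[OF jet_add[OF y z]])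
      (simp add: vec_eq_iff)
qed

lemma hermite_dofs_scale:
  assumes "z \<in> Z3_red v"
  shows "hermite_dofs v (c *\<^sub>R z) = c *\<^sub>R hermite_dofs v z"
proof -
  obtain b k where z: "jet z b k" using assms by (rule Z3_red_jet)
  show ?thesis
    by (simp only: hermite_dofs_jet[OF z] hermite_dofs_jet[OF jet_scale[OF z]]) (simp add: vec_eq_iff)
qed

text \<open>Equal vertex data force equal \<open>\<beta>\<close>.  Then the difference of the traces on a face is an edge sum and is
affine, so the edge coefficients of the difference vanish, and with them its bubble coefficients.\<close>

lemma hermite_dofs_inj: "inj_on (hermite_dofs v) (Z3_red v)"
proof (rule inj_onI)
  fix y z assume "y \<in> Z3_red v" "z \<in> Z3_red v" and eq: "hermite_dofs v y = hermite_dofs v z"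
  then obtain \<beta> c \<beta>' c' where y: "y = corrected \<beta> c" "\<And>k. on_set (face v k) (poly_trace \<beta> c k) \<in> polys_on (face v k) 1"
    and z: "z = corrected \<beta>' c'" "\<And>k. on_set (face v k) (poly_trace \<beta>' c' k) \<in> polys_on (face v k) 1"
    unfolding Z3_red_eq by blast
  have "\<beta> (i, i) = \<beta>' (i, i) \<and> (\<Sum>j\<in>UNIV. \<beta> (i, j) *\<^sub>R g j) = (\<Sum>j\<in>UNIV. \<beta>' (i, j) *\<^sub>R g j)" for i
    using eq unfolding y(1) z(1) hermite_dofs_corrected by (simp add: vec_eq_iff)
  then have "(\<lambda>j. \<beta> (i, j)) = (\<lambda>j. \<beta>' (i, j))" for i
    by (intro gradient_coeff_unique[of "\<lambda>j. \<beta> (i, j)" "\<lambda>j. \<beta>' (i, j)" i]) auto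
  then have \<beta>: "\<beta> = \<beta>'" by (auto simp: fun_eq_iff)
  define d where "d t = c t - c' t" for t
  have "edge_coeff d t = 0" if t: "t \<in> bubble_indices" for t
  proof (rule edge_sum_affine_imp_zero[OF _ t refl])
    let ?k = "fst t"
    have "edge_coeff c = (\<lambda>t. 1 * edge_coeff d t + edge_coeff c' t)"
      by (simp add: edge_coeff_def d_def fun_eq_iff algebra_simps)
    then have "edge_sum (edge_coeff c) ?k x = 1 * edge_sum (edge_coeff d) ?k x + edge_sum (edge_coeff c') ?k x" for x
      by (simp only: edge_sum_lincomb)
    then have "on_set (face v ?k) (edge_sum (edge_coeff d) ?k)
      = on_set (face v ?k) (poly_trace \<beta> c ?k) - on_set (face v ?k) (poly_trace \<beta>' c' ?k)"
      unfolding on_set_diff \<beta> by (intro on_set_cong) (simp add: poly_trace_def)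
    then show "on_set (face v ?k) (edge_sum (edge_coeff d) ?k) \<in> polys_on (face v ?k) 1"
      using subspace_diff[OF subspace_polys_on y(2)[of ?k] z(2)[of ?k]] by (simp only:)
  qed
  then have "d t = 0" if "t \<in> bubble_indices" for t using edge_coeff_inj that by blast
  then have c: "c t = c' t" if "t \<in> bubble_indices" for t using that by (simp add: d_def)
  have "enriched \<beta> c = enriched \<beta> c'" unfolding enriched_def by (simp only: c cong: sum.cong)
  moreover have "edge_part c k = edge_part c' k" for k unfolding edge_part_def by (simp only: c cong: sum.cong)
  ultimately show "y = z" unfolding y(1) z(1) corrected_def \<beta> by (simp only:)
qed

text \<open>The vertex data give \<open>\<beta>\<close>; the bubble coefficients are then chosen to cancel the non-affine part of
the traces of the polynomial.\<close>

lemma hermite_dofs_surj: "\<exists>z\<in>Z3_red v. hermite_dofs v z = d"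
proof -
  \<comment> \<open>The term \<open>2 * fst (d $ i)\<close> fixes the value at \<open>v\<^sub>i\<close> and cancels in the gradient, as the \<open>g\<^sub>j\<close> sum to zero.\<close>
  define \<beta> where "\<beta> = (\<lambda>(i, j). snd (d $ i) \<bullet> (v j - v i) + 2 * fst (d $ i))"
  have "\<exists>\<gamma>. on_set (face v k) (\<lambda>x. poly_trace \<beta> (\<lambda>t. 0) k x + edge_sum \<gamma> k x) \<in> polys_on (face v k) 1" for k
    using reducible_polys2[OF poly_trace_polys, of k \<beta> "\<lambda>t. 0" k] unfolding reducible_def .
  then obtain \<gamma> where \<gamma>: "\<And>k. on_set (face v k) (\<lambda>x. poly_trace \<beta> (\<lambda>t. 0) k x + edge_sum (\<gamma> k) k x) \<in> polys_on (face v k) 1"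
    by metis
  obtain c where c: "\<And>t. t \<in> bubble_indices \<Longrightarrow> edge_coeff c t = \<gamma> (fst t) t"
    using edge_coeff_surj[of "\<lambda>t. \<gamma> (fst t) t"] by blast
  have pt0: "poly_trace \<beta> c k x = poly_trace \<beta> (\<lambda>t. 0) k x + edge_sum (\<gamma> k) k x" for k x
  proof -
    have "edge_sum (edge_coeff c) k x = edge_sum (\<gamma> k) k x"
      unfolding edge_sum_def by (rule sum.cong) (auto simp: c)
    moreover have "edge_sum (edge_coeff (\<lambda>t. 0)) k x = 0"
      by (simp add: edge_sum_def edge_coeff_def cong: if_cong)
    ultimately show ?thesis by (simp add: poly_trace_def)
  qed
  have pt: "poly_trace \<beta> c k = (\<lambda>x. poly_trace \<beta> (\<lambda>t. 0) k x + edge_sum (\<gamma> k) k x)" for k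
    by (rule ext) (rule pt0)
  have "\<forall>k. on_set (face v k) (poly_trace \<beta> c k) \<in> polys_on (face v k) 1"
    unfolding pt using \<gamma> by blast
  then have "corrected \<beta> c \<in> Z3_red v" unfolding Z3_red_eq by blast
  moreover have "hermite_dofs v (corrected \<beta> c) = d"
    by (simp add: hermite_dofs_corrected vec_eq_iff \<beta>_def gradient_expansion prod_eq_iff)
  ultimately show ?thesis by blast
qed

end

theorem lemma3p18:
  fixes v :: "4 \<Rightarrow> real^3"
  assumes "nondegenerate v"
  shows "(\<forall>z\<in>Z3_red v. \<forall>i. \<exists>a g.
             (z \<longlongrightarrow> a) (at (v i) within interior (tetrahedron v)) \<and>
             (grad z \<longlongrightarrow> g) (at (v i) within interior (tetrahedron v)))
       \<and> subspace (Z3_red v)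
       \<and> (\<forall>y\<in>Z3_red v. \<forall>z\<in>Z3_red v. hermite_dofs v (y + z) = hermite_dofs v y + hermite_dofs v z)
       \<and> (\<forall>c. \<forall>z\<in>Z3_red v. hermite_dofs v (c *\<^sub>R z) = c *\<^sub>R hermite_dofs v z)
       \<and> bij_betw (hermite_dofs v) (Z3_red v) UNIV"
proof -
  interpret tetra v by unfold_locales (rule assms)
  have "\<exists>a g. (z \<longlongrightarrow> a) (at (v i) within I) \<and> (grad z \<longlongrightarrow> g) (at (v i) within I)"
    if z: "z \<in> Z3_red v" for z i
  proof -
    obtain a h where "jet z a h" using z by (rule Z3_red_jet)
    then show ?thesis using vertex_boundary unfolding jet_def by blast
  qed
  moreover have "hermite_dofs v ` Z3_red v = UNIV"
  proof (intro equalityI subset_UNIV subsetI)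
    fix d
    obtain z where "z \<in> Z3_red v" "hermite_dofs v z = d" using hermite_dofs_surj by (rule bexE)
    then show "d \<in> hermite_dofs v ` Z3_red v" by (intro image_eqI[of _ _ z]) auto
  qed
  ultimately show ?thesis
    by (intro conjI ballI allI bij_betw_imageI subspace_Z3_red hermite_dofs_add hermite_dofs_scale hermite_dofs_inj)
qed

end
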